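(* Let $a>b>0$, $0<\lambda<b^2$, $c=\sqrt{a^2-b^2}$, let $E=\{\frac{x^2}{a^2}+\frac{y^2}{b^2}=1\}$ be the billiard table and $E_\lambda=\{\frac{x^2}{a^2-\lambda}+\frac{y^2}{b^2-\lambda}=1\}$ a confocal caustic, and put $f=\frac{\sqrt{a^2-\lambda}}{c}$. Let $\rho$ be the rotation number of the billiard in $E$ on the invariant curve corresponding to the caustic $E_\lambda$, and let $|E_\lambda|$ be the perimeter of $E_\lambda$. Then the Mather $\beta$-function of the billiard in $E$ satisfies $$\beta(\rho)=\frac{2a\sqrt\lambda}{b}-2\sqrt{a^2-\lambda}\,E(\phi,k)+\rho\,|E_\lambda|,\qquad \phi=\arcsin\frac{\sqrt\lambda}{b},\quad k=\frac1f .$$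
   Context: $E(\varphi,k)=\int_0^\varphi\sqrt{1-k^2\sin^2t}\,dt$ is the elliptic integral of the second kind. Billiard trajectories in $E$ with one edge tangent to $E_\lambda$ have all edges tangent to $E_\lambda$ (the trajectory circumscribes $E_\lambda$); they are traversed counterclockwise. The oriented lines tangent counterclockwise to $E_\lambda$ form the invariant curve of the billiard map corresponding to $E_\lambda$. The rotation number $\rho\in(0,\tfrac12)$ of this curve is the average number of turns around the centre per reflection: if a trajectory closes after $n$ reflections making $m$ turns, then $\rho=m/n$; in general, if $\theta_i$ is a continuously lifted polar angle of the $i$-th reflection point, with $0<\theta_{i+1}-\theta_i<2\pi$, then $\rho=\lim_{N\to\infty}\frac{\theta_N-\theta_0}{2\pi N}$. Mather $\beta$-function of the ellipse (with sign $+$ convention): $\beta(\rho)$ is the average length per edge of the billiard trajectories circumscribing $E_\lambda$. That is, for $\rho=m/n$ all the billiard trajectories circumscribing $E_\lambda$ are closed $n$-gons (Poncelet polygons) of the same perimeter and $\beta(m/n)$ is this perimeter divided by $n$; for arbitrary $\rho$, $\beta(\rho)=\lim_{N\to\infty}\frac1N\sum_{i=1}^N|P_{i-1}P_i|$ where $P_0,P_1,\dots$ are the consecutive reflection points of such a trajectory. *)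

theory Defs
  imports "HOL-Analysis.Analysis"
begin

text \<open>
  The plane is identified with \<^typ>\<open>complex\<close>, so that a polar angle of a point is a real
  \<open>t\<close> with \<open>z = cmod z * cis t\<close>, and \<open>\<i> * v\<close> is \<open>v\<close> turned counterclockwise by a right angle.
\<close>

definition elliptic_E :: "real \<Rightarrow> real \<Rightarrow> real" where
  \<comment> \<open>Meant for \<open>\<phi> \<ge> 0\<close>: the integral over an empty interval is 0.\<close>
  "elliptic_E \<phi> k = integral {0..\<phi>} (\<lambda>t. sqrt (1 - k\<^sup>2 * (sin t)\<^sup>2))"

definition confocal_ellipse :: "real \<Rightarrow> real \<Rightarrow> real \<Rightarrow> complex set" where
  \<comment> \<open>The billiard table is the member \<open>l = 0\<close> of the confocal family.\<close>
  "confocal_ellipse a b l = {z. (Re z)\<^sup>2 / (a\<^sup>2 - l) + (Im z)\<^sup>2 / (b\<^sup>2 - l) = 1}"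

definition ellipse_normal :: "real \<Rightarrow> real \<Rightarrow> real \<Rightarrow> complex \<Rightarrow> complex" where
  \<comment> \<open>Half the gradient of the quadratic form defining the ellipse: an outer normal at \<open>z\<close>.\<close>
  "ellipse_normal a b l z = Complex (Re z / (a\<^sup>2 - l)) (Im z / (b\<^sup>2 - l))"

definition reflect :: "complex \<Rightarrow> complex \<Rightarrow> complex" where
  \<comment> \<open>Reflection of \<open>u\<close> in the line through 0 orthogonal to \<open>n\<close>.\<close>
  "reflect n u = u - (2 * (u \<bullet> n) / (n \<bullet> n)) *\<^sub>R n"

definition billiard_trajectory :: "real \<Rightarrow> real \<Rightarrow> (nat \<Rightarrow> complex) \<Rightarrow> bool" where
  "billiard_trajectory a b P \<longleftrightarrow>
     (\<forall>i. P i \<in> confocal_ellipse a b 0 \<and> P i \<noteq> P (Suc i) \<and>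
          sgn (P (Suc (Suc i)) - P (Suc i)) =
            reflect (ellipse_normal a b 0 (P (Suc i))) (sgn (P (Suc i) - P i)))"

definition tangent_ccw :: "real \<Rightarrow> real \<Rightarrow> real \<Rightarrow> complex \<Rightarrow> complex \<Rightarrow> bool" where
  \<comment> \<open>The line \<open>AB\<close>, oriented from \<open>A\<close> to \<open>B\<close>, touches the ellipse counterclockwise at \<open>T\<close>.\<close>
  "tangent_ccw a b l A B \<longleftrightarrow>
     (\<exists>T \<in> confocal_ellipse a b l. T \<in> affine hull {A, B} \<and>
        (\<exists>s>0. B - A = s *\<^sub>R (\<i> * ellipse_normal a b l T)))"

definition circumscribing_trajectory :: "real \<Rightarrow> real \<Rightarrow> real \<Rightarrow> (nat \<Rightarrow> complex) \<Rightarrow> bool" where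
  "circumscribing_trajectory a b l P \<longleftrightarrow>
     billiard_trajectory a b P \<and> (\<forall>i. tangent_ccw a b l (P i) (P (Suc i)))"

definition lifted_polar_angle :: "(nat \<Rightarrow> complex) \<Rightarrow> (nat \<Rightarrow> real) \<Rightarrow> bool" where
  "lifted_polar_angle P \<theta> \<longleftrightarrow>
     (\<forall>i. P i = cmod (P i) * cis (\<theta> i) \<and> 0 < \<theta> (Suc i) - \<theta> i \<and> \<theta> (Suc i) - \<theta> i < 2 * pi)"

definition rotation_number :: "real \<Rightarrow> real \<Rightarrow> real \<Rightarrow> real" where
  \<comment> \<open>The common limit for all trajectories circumscribing the caustic.\<close>
  "rotation_number a b l =
     (THE r. \<forall>P \<theta>. circumscribing_trajectory a b l P \<and> lifted_polar_angle P \<theta> \<longrightarrow>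
        (\<lambda>N. (\<theta> N - \<theta> 0) / (2 * pi * real N)) \<longlonglongrightarrow> r)"

definition mather_beta :: "real \<Rightarrow> real \<Rightarrow> real \<Rightarrow> real" where
  \<comment> \<open>A function of the rotation number: the value is the common mean edge length of all
     trajectories circumscribing some confocal ellipse of rotation number \<open>r\<close>.
     For \<open>r = m/n\<close> these are closed \<open>n\<close>-gons and the limit is the perimeter divided by \<open>n\<close>.\<close>
  "mather_beta a b r =
     (THE L. \<forall>l P. 0 < l \<and> l < b\<^sup>2 \<and> rotation_number a b l = r \<and>
        circumscribing_trajectory a b l P \<longrightarrow>
        (\<lambda>N. (\<Sum>i=1..N. dist (P (i - 1)) (P i)) / real N) \<longlonglongrightarrow> L)"

definition confocal_perimeter :: "real \<Rightarrow> real \<Rightarrow> real \<Rightarrow> real" where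
  \<comment> \<open>Arc length of the closed curve that traverses the ellipse once.\<close>
  "confocal_perimeter a b l =
     integral {0..2 * pi} (\<lambda>t. norm (vector_derivative
       (\<lambda>s. Complex (sqrt (a\<^sup>2 - l) * cos s) (sqrt (b\<^sup>2 - l) * sin s)) (at t)))"

end

theory Submission
  imports Defs
begin

text \<open>
  Let \<open>t\<close> be the eccentric angle on the caustic. A point of the table is the intersection of the tangents to the
  caustic at \<open>m - d\<close> and \<open>m + d\<close>, where \<open>d\<close> is an explicit function of \<open>m\<close>. The speeds of the caustic at
  these two angles are \<open>\<kappa> (sin d cos d \<plusminus> w)\<close> with \<open>d' = w / (sin d cos d)\<close> and a constant \<open>\<kappa>\<close>. Differentiation in
  \<open>m\<close> then shows that the measure \<open>dt / speed\<close> of \<open>[m - d, m + d]\<close> does not depend on \<open>m\<close>, so the billiard map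
  is conjugate to a rotation, and that the two tangent segments exceed the arc between them by a constant
  (Graves). Summing the latter along a trajectory gives the mean edge length as this constant plus the
  rotation number times the perimeter; the constant is evaluated at the vertex on the minor axis.
  The rotation number is strictly increasing in \<open>l\<close>, so it determines the caustic and the
  \<open>\<beta>\<close>-function is well defined.
\<close>

section \<open>Averages and antiderivatives\<close>

text \<open>Rotation number and mean edge length are both obtained from a bounded deviation from
  linear growth, so closed and non-closed trajectories are treated alike.\<close>

lemma tendsto_average_of_bounded_deviation:
  fixes x :: "nat \<Rightarrow> real"
  assumes "\<And>N. \<bar>x N - real N * c\<bar> \<le> K"
  shows "(\<lambda>N. x N / real N) \<longlonglongrightarrow> c"
proof -
  have "(\<lambda>N. K / real N) \<longlonglongrightarrow> 0"
    by (rule lim_const_over_n)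
  then have "(\<lambda>N. x N / real N - c) \<longlonglongrightarrow> 0"
  proof (rule Lim_null_comparison[rotated])
    show "\<forall>\<^sub>F N in sequentially. norm (x N / real N - c) \<le> K / real N"
      using eventually_gt_at_top[of 0]
    proof eventually_elim
      case (elim N)
      have "x N / real N - c = (x N - real N * c) / real N"
        using elim by (simp add: field_simps)
      then show ?case
        using assms[of N] by (simp add: abs_divide divide_right_mono)
    qed
  qed
  then show ?thesis
    by (simp add: LIM_zero_iff)
qed

lemma antiderivative_exists:
  fixes f :: "real \<Rightarrow> real"
  assumes "continuous_on UNIV f"
  shows "\<exists>F. \<forall>t. (F has_real_derivative f t) (at t)"
proof -
  have "\<exists>F. \<forall>x::real. -\<infinity> < ereal x \<longrightarrow> ereal x < \<infinity> \<longrightarrow> (F has_vector_derivative f x) (at x)"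
    using assms by (intro einterval_antiderivative) (auto simp: continuous_on_eq_continuous_at)
  then show ?thesis
    by (simp add: has_real_derivative_iff_has_vector_derivative)
qed

lemma integral_eq_antiderivative_diff:
  fixes f F :: "real \<Rightarrow> real"
  assumes "\<And>t. (F has_real_derivative f t) (at t)" and "a \<le> b"
  shows "integral {a..b} f = F b - F a"
  using assms
  by (intro integral_unique fundamental_theorem_of_calculus)
     (auto intro: has_vector_derivative_at_within simp: has_real_derivative_iff_has_vector_derivative)

text \<open>An integrand depending only on \<open>(sin t)^2\<close> is symmetric about
  \<open>pi / 2\<close> and has period \<open>pi\<close>. The instances are arc length on the
  caustic and the invariant time \<open>dt / speed t\<close>.\<close>

locale sin_sq_antiderivative =
  fixes F :: "real \<Rightarrow> real" and h :: "real \<Rightarrow> real"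
  assumes deriv_F: "\<And>t. (F has_real_derivative h ((sin t)\<^sup>2)) (at t)"
begin

lemma reflect_pi_half: "F (pi / 2 + s) - F (pi / 2) = F (pi / 2) - F (pi / 2 - s)"
proof -
  let ?G = "\<lambda>s. F (pi / 2 + s) + F (pi / 2 - s)"
  have "(?G has_real_derivative 0) (at s)" for s
    by (auto intro!: derivative_eq_intros deriv_F[THEN DERIV_chain2] simp: sin_add sin_diff)
  then have "?G s = ?G 0"
    by (intro DERIV_isconst_all) auto
  then show ?thesis
    by simp
qed

lemma shift_pi: "F (t + pi) = F t + 2 * (F pi - F (pi / 2))"
proof -
  let ?G = "\<lambda>t. F (t + pi) - F t"
  have "(?G has_real_derivative 0) (at s)" for s
    by (auto intro!: derivative_eq_intros deriv_F[THEN DERIV_chain2])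
  then have "?G t = ?G 0"
    by (intro DERIV_isconst_all) auto
  \<comment> \<open>The increment over \<open>[0, pi]\<close> is twice the one over
    \<open>[pi / 2, pi]\<close> by the reflection, taken at \<open>s = pi / 2\<close>.\<close>
  then show ?thesis
    using reflect_pi_half[of "pi / 2"] by simp
qed

lemma shift_two_pi: "F (t + 2 * pi) = F t + 4 * (F pi - F (pi / 2))"
  using shift_pi[of "t + pi"] shift_pi[of t] by (simp add: algebra_simps)

text \<open>After subtraction of its mean slope \<open>F\<close> is continuous with period
  \<open>pi\<close>, hence bounded by its values on \<open>[0, pi]\<close>.\<close>

lemma linear_growth: "\<exists>K. \<forall>t. \<bar>F t - t / pi * (2 * (F pi - F (pi / 2)))\<bar> \<le> K"
proof -
  define V where "V = 2 * (F pi - F (pi / 2))"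
  let ?G = "\<lambda>t. F t - t / pi * V"
  have step: "?G (t + pi) = ?G t" for t
    using shift_pi[of t] by (simp add: V_def add_divide_distrib distrib_right)
  have nat_shift: "?G (t + real n * pi) = ?G t" for t n
  proof (induction n)
    case (Suc n)
    then show ?case
      using step[of "t + real n * pi"] by (simp add: algebra_simps)
  qed simp
  have int_shift: "?G (t + of_int k * pi) = ?G t" for t k
  proof (cases k rule: int_cases2)
    case (nonneg n)
    then show ?thesis using nat_shift[of t n] by simp
  next
    case (nonpos n)
    then show ?thesis using nat_shift[of "t + of_int k * pi" n] by simp
  qed
  have "isCont F t" for t
    using deriv_F by (rule DERIV_isCont)
  then have "continuous_on {0..pi} ?G"
    by (intro continuous_intros) (auto simp: continuous_on_eq_continuous_within continuous_at_imp_continuous_at_within)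
  then have "bounded (?G ` {0..pi})"
    by (intro compact_imp_bounded compact_continuous_image) auto
  then obtain K where K: "\<And>t. t \<in> {0..pi} \<Longrightarrow> \<bar>?G t\<bar> \<le> K"
    unfolding bounded_iff by fastforce
  have "\<bar>?G t\<bar> \<le> K" for t
  proof -
    let ?k = "\<lfloor>t / pi\<rfloor>"
    have "of_int ?k \<le> t / pi" "t / pi < of_int ?k + 1"
      by linarith+
    then have "of_int ?k * pi \<le> t" "t \<le> (of_int ?k + 1) * pi"
      by (simp_all only: pos_le_divide_eq pos_divide_less_eq pi_gt_zero less_imp_le)
    then have "t + of_int (- ?k) * pi \<in> {0..pi}"
      by (simp add: algebra_simps)
    from K[OF this] show ?thesis
      using int_shift[of t "- ?k"] by simp
  qed
  then show ?thesis
    unfolding V_def by blast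
qed

end

section \<open>Angles and reflections\<close>

text \<open>Equality of the norms forces the coefficient \<open>\<mu>\<close> to be that of the
  reflection, so a reflection law can be verified by checking that the difference of the directions
  is normal.\<close>

lemma reflect_eqI:
  assumes "u - v = \<mu> *\<^sub>R n" "\<mu> \<noteq> 0" "norm u = norm v"
  shows "reflect n u = v"
proof -
  have v: "v = u - \<mu> *\<^sub>R n"
    using assms(1) by (simp add: algebra_simps)
  have "u \<bullet> u = v \<bullet> v"
    using assms(3) by (simp add: dot_square_norm)
  also have "\<dots> = u \<bullet> u - \<mu> * (2 * (u \<bullet> n) - \<mu> * (n \<bullet> n))"
    by (simp add: v inner_diff_left inner_diff_right inner_commute algebra_simps)
  finally have *: "2 * (u \<bullet> n) = \<mu> * (n \<bullet> n)"
    using assms(2) by simp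
  show ?thesis
    by (cases "n = 0") (simp_all add: reflect_def * v)
qed

text \<open>Cosine is not positive between \<open>pi / 2\<close> and \<open>3 * pi / 2\<close>. This
  sharpens crude bounds when polar angles are compared with eccentric angles.\<close>

lemma abs_less_pi_half_if_cos_pos:
  assumes "cos x > 0" "\<bar>x\<bar> < 3 * pi / 2"
  shows "\<bar>x\<bar> < pi / 2"
proof (rule ccontr)
  assume "\<not> \<bar>x\<bar> < pi / 2"
  with assms(2) have "cos (\<bar>x\<bar> - pi) \<ge> 0"
    by (intro cos_ge_zero) auto
  with assms(1) show False
    by (simp add: cos_diff)
qed

lemma cos_diff_multiple_two_pi: "cos (x - 2 * pi * of_int k) = cos (x::real)"
  by (simp add: cos_diff cos_int_2pin sin_int_2pin)

lemma cos_pos_imp_near_multiple: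
  assumes "cos x > 0"
  shows "\<exists>k::int. \<bar>x - 2 * pi * of_int k\<bar> < pi / 2"
proof -
  \<comment> \<open>The integer nearest to \<open>x / (2 * pi)\<close>.\<close>
  define k where "k = \<lfloor>x / (2 * pi) + 1 / 2\<rfloor>"
  have "of_int k \<le> x / (2 * pi) + 1 / 2" "x / (2 * pi) + 1 / 2 < of_int k + 1"
    unfolding k_def by linarith+
  then have "\<bar>x - 2 * pi * of_int k\<bar> \<le> pi"
    by (auto simp: field_simps abs_le_iff)
  then have "\<bar>x - 2 * pi * of_int k\<bar> < 3 * pi / 2"
    using pi_gt_zero by linarith
  moreover have "cos (x - 2 * pi * of_int k) > 0"
    using assms by (simp add: cos_diff_multiple_two_pi)
  ultimately show ?thesis
    by (intro exI abs_less_pi_half_if_cos_pos)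
qed

lemma cos_arctan_squared: "(cos (arctan y))\<^sup>2 = 1 / (1 + y\<^sup>2)"
  by (simp add: cos_arctan power_divide)

section \<open>Tangents from a point of the table to the caustic\<close>

locale confocal_caustic =
  fixes a b l :: real
  assumes ab: "a > b" and b0: "b > 0" and l0: "0 < l" and lb: "l < b\<^sup>2"
begin

definition "A = sqrt (a\<^sup>2 - l)"
definition "B = sqrt (b\<^sup>2 - l)"
definition "speed t = sqrt (b\<^sup>2 - l + (a\<^sup>2 - b\<^sup>2) * (sin t)\<^sup>2)"
text \<open>The quadratic form of the table, evaluated at \<open>caustic_point m\<close>.\<close>

definition "g m = (a\<^sup>2 - l) / a\<^sup>2 * (cos m)\<^sup>2 + (b\<^sup>2 - l) / b\<^sup>2 * (sin m)\<^sup>2"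
definition "d m = arccos (sqrt (g m))"
text \<open>Minus half the derivative of \<open>g\<close>.\<close>

definition "w m = l * (a\<^sup>2 - b\<^sup>2) / (a\<^sup>2 * b\<^sup>2) * sin m * cos m"
definition "\<kappa> = a * b / sqrt l"
definition "caustic_point t = Complex (A * cos t) (B * sin t)"
definition "caustic_tangent t = Complex (- A * sin t) (B * cos t)"
definition vertex where
  \<comment> \<open>The point whose tangents touch the caustic at \<open>m - d m\<close> and \<open>m + d m\<close>; it is on the table because
     \<open>(cos (d m))\<^sup>2 = g m\<close>.\<close>
  "vertex m = Complex (A * cos m / cos (d m)) (B * sin m / cos (d m))"

section \<open>Signs, and the half-angle between the tangents from a table point\<close>

lemma a0: "a > 0" using ab b0 by linarith
lemma sq_ab: "b\<^sup>2 < a\<^sup>2" using ab b0 by (intro power_strict_mono) auto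
lemma la: "l < a\<^sup>2" using lb sq_ab by linarith
lemma A_pos: "A > 0" and A_sq: "A\<^sup>2 = a\<^sup>2 - l" using la by (auto simp: A_def)
lemma B_pos: "B > 0" and B_sq: "B\<^sup>2 = b\<^sup>2 - l" using lb by (auto simp: B_def)
lemma \<kappa>_pos: "\<kappa> > 0" and \<kappa>_sq: "\<kappa>\<^sup>2 = a\<^sup>2 * b\<^sup>2 / l"
  using a0 b0 l0 by (auto simp: \<kappa>_def power_divide power_mult_distrib)

lemma speed_radicand_pos: "b\<^sup>2 - l + (a\<^sup>2 - b\<^sup>2) * (sin t)\<^sup>2 > 0"
  using lb sq_ab by (intro add_pos_nonneg) auto
lemma speed_pos: "speed t > 0" and speed_sq: "(speed t)\<^sup>2 = b\<^sup>2 - l + (a\<^sup>2 - b\<^sup>2) * (sin t)\<^sup>2"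
  using speed_radicand_pos[of t] by (auto simp: speed_def)

lemma norm_caustic_tangent: "cmod (caustic_tangent t) = speed t"
  by (simp add: caustic_tangent_def cmod_def speed_def power_mult_distrib A_sq B_sq cos_squared_eq algebra_simps)

lemma g_alt: "g m = (a\<^sup>2 - l) / a\<^sup>2 - l * (a\<^sup>2 - b\<^sup>2) / (a\<^sup>2 * b\<^sup>2) * (sin m)\<^sup>2"
  using a0 b0 by (simp add: g_def cos_squared_eq field_simps)

text \<open>A convex combination of two numbers strictly between 0 and 1. Geometrically, the caustic
  lies strictly inside the table.\<close>

lemma g_pos: "g m > 0" and g_less_1: "g m < 1"
proof -
  have "0 < (a\<^sup>2 - l) / a\<^sup>2" "(a\<^sup>2 - l) / a\<^sup>2 < 1" "0 < (b\<^sup>2 - l) / b\<^sup>2" "(b\<^sup>2 - l) / b\<^sup>2 < 1"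
    using a0 b0 l0 lb la by auto
  moreover have "g m \<ge> min ((a\<^sup>2 - l) / a\<^sup>2) ((b\<^sup>2 - l) / b\<^sup>2) * ((cos m)\<^sup>2 + (sin m)\<^sup>2)"
    unfolding g_def distrib_left by (intro add_mono mult_right_mono) auto
  moreover have "g m \<le> max ((a\<^sup>2 - l) / a\<^sup>2) ((b\<^sup>2 - l) / b\<^sup>2) * ((cos m)\<^sup>2 + (sin m)\<^sup>2)"
    unfolding g_def distrib_left by (intro add_mono mult_right_mono) auto
  ultimately show "g m > 0" "g m < 1"
    by (auto simp: min_def max_def split: if_splits)
qed

lemma cos_d: "cos (d m) = sqrt (g m)" and d_pos: "0 < d m" and d_less: "d m < pi / 2"
proof -
  have g: "0 < sqrt (g m)" "sqrt (g m) < 1"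
    using g_pos[of m] g_less_1[of m] by (auto simp: real_sqrt_lt_1_iff)
  show "cos (d m) = sqrt (g m)"
    unfolding d_def using g by (intro cos_arccos) linarith+
  show "0 < d m"
    unfolding d_def using g arccos_lt_bounded[of "sqrt (g m)"] by linarith
  show "d m < pi / 2"
    unfolding d_def using g arccos_less_arccos[of 0 "sqrt (g m)"] by auto
qed

lemma cos_d_pos: "cos (d m) > 0" and cos_d_sq: "(cos (d m))\<^sup>2 = g m"
  using cos_d g_pos[of m] by auto

lemma sin_d_pos: "sin (d m) > 0" and sin_d_sq: "(sin (d m))\<^sup>2 = 1 - g m"
  using d_pos[of m] d_less[of m] sin_gt_zero[of "d m"] cos_d_sq[of m] by (auto simp: sin_squared_eq)

lemma tan_d_pos: "tan (d m) > 0"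
  using sin_d_pos cos_d_pos by (simp add: tan_def)

lemma d_unique:
  assumes "0 < e" "e < pi / 2" "(cos e)\<^sup>2 = g m"
  shows "e = d m"
proof -
  have "cos e > 0"
    using assms by (intro cos_gt_zero_pi) auto
  then have "sqrt (g m) = cos e"
    using assms(3) by (metis less_imp_le real_sqrt_abs2 real_sqrt_unique)
  then show ?thesis
    unfolding d_def using assms by (simp add: arccos_cos)
qed

lemma g_shift: "g (m + 2 * pi * of_int k) = g m"
  using sin_cos_eq_iff[of "m + 2 * pi * of_int k" m] by (auto simp: g_def)

text \<open>With \<open>g m = (1 - x) * \<alpha> + x * \<beta>\<close>, the difference of the
  squares reduces, as in the formula for a variance, to a convex combination of
  \<open>\<alpha> * (1 - \<alpha>)\<close> and \<open>\<beta> * (1 - \<beta>)\<close>. The strict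
  bound later selects the positive square root in \<open>speed_tangency\<close>.\<close>

lemma w_bound: "\<bar>w m\<bar> < sin (d m) * cos (d m)"
proof -
  define \<alpha> \<beta> x where "\<alpha> = (a\<^sup>2 - l) / a\<^sup>2" and "\<beta> = (b\<^sup>2 - l) / b\<^sup>2" and "x = (sin m)\<^sup>2"
  have ab_bds: "0 < \<alpha> * (1 - \<alpha>)" "0 < \<beta> * (1 - \<beta>)"
    using a0 b0 l0 lb la by (auto simp: \<alpha>_def \<beta>_def)
  have x: "0 \<le> x" "x \<le> 1" "(cos m)\<^sup>2 = 1 - x"
    by (auto simp: x_def cos_squared_eq abs_square_le_1)
  have g: "g m = \<alpha> - (\<alpha> - \<beta>) * x"
    unfolding g_def \<alpha>_def[symmetric] \<beta>_def[symmetric] x x_def[symmetric] by (simp add: algebra_simps)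
  have "\<alpha> - \<beta> = l * (a\<^sup>2 - b\<^sup>2) / (a\<^sup>2 * b\<^sup>2)"
    using a0 b0 by (simp add: \<alpha>_def \<beta>_def field_simps)
  then have "w m = (\<alpha> - \<beta>) * (sin m * cos m)"
    by (simp add: w_def)
  then have "(w m)\<^sup>2 = (\<alpha> - \<beta>)\<^sup>2 * (x * (1 - x))"
    by (simp add: power_mult_distrib x_def x(3)[unfolded x_def])
  moreover have "(sin (d m) * cos (d m))\<^sup>2 = (1 - g m) * g m"
    by (simp add: power_mult_distrib sin_d_sq cos_d_sq)
  ultimately have "(sin (d m) * cos (d m))\<^sup>2 - (w m)\<^sup>2 = (1 - x) * (\<alpha> * (1 - \<alpha>)) + x * (\<beta> * (1 - \<beta>))"
    unfolding g by algebra
  also have "\<dots> > 0"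
  proof (cases "x = 0")
    case False
    then show ?thesis using ab_bds x by (intro add_nonneg_pos) auto
  qed (use ab_bds in simp)
  finally have "\<bar>w m\<bar>\<^sup>2 < (sin (d m) * cos (d m))\<^sup>2"
    by simp
  then show ?thesis
    using sin_d_pos[of m] cos_d_pos[of m] by (meson less_imp_le mult_pos_pos power_less_imp_less_base)
qed

lemma w_bounds: "0 < sin (d m) * cos (d m) + w m" "0 < sin (d m) * cos (d m) - w m"
  using w_bound[of m] by (auto simp: abs_less_iff)

text \<open>For \<open>x = (sin m)^2\<close>, \<open>y = (cos m)^2\<close> and
  \<open>G = g m\<close> this is the part of \<open>(speed (m + d m))^2\<close> and
  \<open>(speed (m - d m))^2\<close> common to both. Once denominators are cleared, it is a
  polynomial identity modulo the linear equation for \<open>G\<close>.\<close>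

lemma speed_identity:
  assumes x: "x + y = 1" and G: "G = (a\<^sup>2 - l) / a\<^sup>2 * y + (b\<^sup>2 - l) / b\<^sup>2 * x"
  shows "b\<^sup>2 - l + (a\<^sup>2 - b\<^sup>2) * (x * G + y * (1 - G))
    = a\<^sup>2 * b\<^sup>2 / l * ((1 - G) * G + (l * (a\<^sup>2 - b\<^sup>2) / (a\<^sup>2 * b\<^sup>2))\<^sup>2 * (x * y))"
proof -
  define p q where "p = a\<^sup>2" and "q = b\<^sup>2"
  have pos: "p > 0" "q > 0" "p \<noteq> 0" "q \<noteq> 0" "l \<noteq> 0"
    using a0 b0 l0 by (auto simp: p_def q_def)
  have y: "y = 1 - x" using x by simp
  have G': "G = (p - l) / p * (1 - x) + (q - l) / q * x"
    using G y by (simp add: p_def q_def)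
  have Gpq: "G * (p * q) = (p - l) * (1 - x) * q + (q - l) * x * p"
    unfolding G' using pos by (simp add: field_simps)
  define X where "X = q - l + (p - q) * (x * G + (1 - x) * (1 - G))"
  have "X * (l * (p * q)) = (p * q)\<^sup>2 * ((1 - G) * G) + (l * (p - q))\<^sup>2 * (x * (1 - x))"
    using Gpq unfolding X_def by algebra
  then have "X = ((p * q)\<^sup>2 * ((1 - G) * G) + (l * (p - q))\<^sup>2 * (x * (1 - x))) / (l * (p * q))"
    using pos by (simp add: field_simps)
  also have "\<dots> = p * q / l * ((1 - G) * G + (l * (p - q) / (p * q))\<^sup>2 * (x * (1 - x)))"
    using pos by (simp add: add_divide_distrib distrib_left power2_eq_square)
  finally show ?thesis
    by (simp add: X_def p_def q_def y)
qed

lemma speed_tangency: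
  shows speed_plus: "speed (m + d m) = \<kappa> * (sin (d m) * cos (d m) + w m)"
    and speed_minus: "speed (m - d m) = \<kappa> * (sin (d m) * cos (d m) - w m)"
proof -
  define sm cm sd cd where "sm = sin m" and "cm = cos m" and "sd = sin (d m)" and "cd = cos (d m)"
  note defs = sm_def cm_def sd_def cd_def
  define q where "q = l * (a\<^sup>2 - b\<^sup>2) / (a\<^sup>2 * b\<^sup>2)"
  have w: "w m = q * (sm * cm)"
    by (simp add: w_def q_def defs)
  have sq: "sd\<^sup>2 = 1 - g m" "cd\<^sup>2 = g m"
    by (simp_all add: defs sin_d_sq cos_d_sq)
  have id: "b\<^sup>2 - l + (a\<^sup>2 - b\<^sup>2) * (sm\<^sup>2 * cd\<^sup>2 + cm\<^sup>2 * sd\<^sup>2)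
    = a\<^sup>2 * b\<^sup>2 / l * (sd\<^sup>2 * cd\<^sup>2 + q\<^sup>2 * (sm\<^sup>2 * cm\<^sup>2))"
    unfolding sq q_def by (rule speed_identity) (simp_all add: g_def defs)
  \<comment> \<open>This matches the mixed terms \<open>sm * cm * sd * cd\<close>, which enter the
    two squared speeds with opposite signs; \<open>id\<close> matches the rest.\<close>
  have q: "a\<^sup>2 - b\<^sup>2 = a\<^sup>2 * b\<^sup>2 / l * q"
    using a0 b0 l0 by (simp add: q_def)
  have "(speed (m + d m))\<^sup>2 = (\<kappa> * (sd * cd + w m))\<^sup>2"
    using id q unfolding speed_sq power_mult_distrib \<kappa>_sq w sin_add sm_def[symmetric] cm_def[symmetric] sd_def[symmetric] cd_def[symmetric]
    by algebra
  then show "speed (m + d m) = \<kappa> * (sin (d m) * cos (d m) + w m)"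
    unfolding defs[symmetric]
    using \<kappa>_pos w_bounds[of m] speed_pos[of "m + d m"] by (simp add: defs power2_eq_iff_nonneg less_imp_le)
  have "(speed (m - d m))\<^sup>2 = (\<kappa> * (sd * cd - w m))\<^sup>2"
    using id q unfolding speed_sq power_mult_distrib \<kappa>_sq w sin_diff sm_def[symmetric] cm_def[symmetric] sd_def[symmetric] cd_def[symmetric]
    by algebra
  then show "speed (m - d m) = \<kappa> * (sin (d m) * cos (d m) - w m)"
    unfolding defs[symmetric]
    using \<kappa>_pos w_bounds[of m] speed_pos[of "m - d m"] by (simp add: defs power2_eq_iff_nonneg less_imp_le)
qed

text \<open>Implicitly, \<open>(cos (d m))^2 = g m\<close> and \<open>g' = - 2 * w\<close> give
  \<open>sin d * cos d * d' = w\<close>; the explicit form of \<open>d\<close> supplies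
  differentiability.\<close>

lemma deriv_d: "(d has_real_derivative w m / (sin (d m) * cos (d m))) (at m)"
proof -
  have g: "0 < sqrt (g m)" "sqrt (g m) < 1"
    using g_pos[of m] g_less_1[of m] by (auto simp: real_sqrt_lt_1_iff)
  have dg: "(g has_real_derivative - 2 * w m) (at m)"
    unfolding g_def[abs_def] w_def using a0 b0
    by (auto intro!: derivative_eq_intros simp: field_simps power2_eq_square)
  have "sqrt (1 - g m) = sin (d m)"
    using sin_d_pos[of m] sin_d_sq[of m] by (metis abs_of_pos real_sqrt_abs)
  moreover have "((\<lambda>m. sqrt (g m)) has_real_derivative - w m / sqrt (g m)) (at m)"
    using DERIV_chain2[OF DERIV_real_sqrt[OF g_pos] dg] g by (simp add: field_simps)
  moreover have "(arccos has_real_derivative inverse (- sqrt (1 - (sqrt (g m))\<^sup>2))) (at (sqrt (g m)))"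
    using g by (intro DERIV_arccos) linarith+
  ultimately have "((\<lambda>m. arccos (sqrt (g m))) has_real_derivative
      inverse (- sqrt (1 - (sqrt (g m))\<^sup>2)) * (- w m / sqrt (g m))) (at m)"
    by (metis DERIV_chain2)
  then show ?thesis
    unfolding d_def[abs_def, symmetric] using \<open>sqrt (1 - g m) = sin (d m)\<close> g_pos[of m]
    by (simp add: cos_d field_simps)
qed

text \<open>The derivatives \<open>1 + d'\<close> and \<open>1 - d'\<close> are the speeds at the
  two tangency points divided by the same factor. Hence both ends of the tangency interval move at
  equal rates in the measure \<open>dt / speed t\<close>, and both invariants below follow.\<close>

lemma deriv_plus: "((\<lambda>m. m + d m) has_real_derivative speed (m + d m) / (\<kappa> * (sin (d m) * cos (d m)))) (at m)"
    and deriv_minus: "((\<lambda>m. m - d m) has_real_derivative speed (m - d m) / (\<kappa> * (sin (d m) * cos (d m)))) (at m)"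
proof -
  have nz: "sin (d m) \<noteq> 0" "cos (d m) \<noteq> 0" "\<kappa> \<noteq> 0"
    using sin_d_pos[of m] cos_d_pos[of m] \<kappa>_pos by auto
  have "speed (m + d m) / (\<kappa> * (sin (d m) * cos (d m))) = 1 + w m / (sin (d m) * cos (d m))"
    using nz by (simp add: speed_plus add_divide_distrib)
  with DERIV_add[OF DERIV_ident deriv_d]
  show "((\<lambda>m. m + d m) has_real_derivative speed (m + d m) / (\<kappa> * (sin (d m) * cos (d m)))) (at m)"
    by simp
  have "speed (m - d m) / (\<kappa> * (sin (d m) * cos (d m))) = 1 - w m / (sin (d m) * cos (d m))"
    using nz by (simp add: speed_minus diff_divide_distrib)
  with DERIV_diff[OF DERIV_ident deriv_d]
  show "((\<lambda>m. m - d m) has_real_derivative speed (m - d m) / (\<kappa> * (sin (d m) * cos (d m)))) (at m)"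
    by simp
qed

section \<open>Invariants of the tangency interval\<close>

lemma time_between_tangencies_const:
  assumes H: "\<And>t. (H has_real_derivative 1 / speed t) (at t)"
  shows "H (m + d m) - H (m - d m) = H (n + d n) - H (n - d n)"
proof -
  have "((\<lambda>m. H (m + d m) - H (m - d m)) has_real_derivative 0) (at x)" for x
  proof (rule DERIV_cong)
    show "((\<lambda>m. H (m + d m) - H (m - d m)) has_real_derivative
        1 / speed (x + d x) * (speed (x + d x) / (\<kappa> * (sin (d x) * cos (d x))))
      - 1 / speed (x - d x) * (speed (x - d x) / (\<kappa> * (sin (d x) * cos (d x))))) (at x)"
      by (intro DERIV_diff DERIV_chain2[OF H deriv_plus] DERIV_chain2[OF H deriv_minus])
    show "1 / speed (x + d x) * (speed (x + d x) / (\<kappa> * (sin (d x) * cos (d x))))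
      - 1 / speed (x - d x) * (speed (x - d x) / (\<kappa> * (sin (d x) * cos (d x)))) = 0"
      using speed_pos[of "x + d x"] speed_pos[of "x - d x"] by simp
  qed
  then show ?thesis
    using DERIV_isconst_all[of "\<lambda>m. H (m + d m) - H (m - d m)" m n] by blast
qed

lemma tangent_segments_sum:
  "tan (d m) * speed (m + d m) + tan (d m) * speed (m - d m) = 2 * \<kappa> * (sin (d m))\<^sup>2"
  using cos_d_pos[of m] by (simp add: speed_tangency tan_def field_simps power2_eq_square)

text \<open>Graves' theorem (the string construction): \<open>tan (d m) * speed t\<close> is the length of the tangent segment
  from \<open>vertex m\<close> to the point of tangency \<open>t\<close>.\<close>

lemma string_length_const:
  assumes S: "\<And>t. (S has_real_derivative speed t) (at t)"
  shows "tan (d m) * speed (m + d m) + tan (d m) * speed (m - d m) - (S (m + d m) - S (m - d m))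
       = tan (d n) * speed (n + d n) + tan (d n) * speed (n - d n) - (S (n + d n) - S (n - d n))"
proof -
  let ?f = "\<lambda>m. 2 * \<kappa> * (sin (d m))\<^sup>2 - (S (m + d m) - S (m - d m))"
  have "(?f has_real_derivative 0) (at x)" for x
  proof (rule DERIV_cong)
    define D where "D = cos (d x) * (w x / (sin (d x) * cos (d x)))"
    have "((\<lambda>m. sin (d m)) has_real_derivative D) (at x)"
      unfolding D_def by (intro DERIV_chain2[OF DERIV_sin deriv_d])
    moreover have "((\<lambda>m. c * (u m)\<^sup>2) has_real_derivative c * (2 * u x * D)) (at x)"
      if "(u has_real_derivative D) (at x)" for u :: "real \<Rightarrow> real" and c D
      using that by (auto intro!: derivative_eq_intros)
    ultimately have "((\<lambda>m. 2 * \<kappa> * (sin (d m))\<^sup>2) has_real_derivative 2 * \<kappa> * (2 * sin (d x) * D)) (at x)"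
      by blast
    note * = this[unfolded D_def]
    show "(?f has_real_derivative
        2 * \<kappa> * (2 * sin (d x) * (cos (d x) * (w x / (sin (d x) * cos (d x)))))
        - (speed (x + d x) * (speed (x + d x) / (\<kappa> * (sin (d x) * cos (d x))))
           - speed (x - d x) * (speed (x - d x) / (\<kappa> * (sin (d x) * cos (d x)))))) (at x)"
      by (intro DERIV_diff * DERIV_chain2[OF S deriv_plus] DERIV_chain2[OF S deriv_minus])
    define sc where "sc = sin (d x) * cos (d x)"
    have nz: "sin (d x) \<noteq> 0" "cos (d x) \<noteq> 0" "\<kappa> \<noteq> 0" "sc \<noteq> 0"
      using sin_d_pos[of x] cos_d_pos[of x] \<kappa>_pos by (auto simp: sc_def)
    \<comment> \<open>The difference of the squared speeds is
      \<open>4 * \<kappa>^2 * sc * w x\<close>, so the arc changes at the rate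
      \<open>4 * \<kappa> * w x\<close>, which is also the rate of
      \<open>2 * \<kappa> * (sin (d x))^2\<close>.\<close>
    have "speed (x + d x) * (speed (x + d x) / (\<kappa> * sc)) - speed (x - d x) * (speed (x - d x) / (\<kappa> * sc)) = 4 * \<kappa> * w x"
      unfolding speed_tangency sc_def[symmetric] using nz by (simp add: field_simps)
    then show "2 * \<kappa> * (2 * sin (d x) * (cos (d x) * (w x / (sin (d x) * cos (d x)))))
        - (speed (x + d x) * (speed (x + d x) / (\<kappa> * (sin (d x) * cos (d x))))
           - speed (x - d x) * (speed (x - d x) / (\<kappa> * (sin (d x) * cos (d x))))) = 0"
      using nz by (simp add: sc_def)
  qed
  then have "?f m = ?f n"
    using DERIV_isconst_all[of ?f m n] by blast
  then show ?thesis
    by (simp add: tangent_segments_sum)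
qed

text \<open>Controls the end terms of the telescoping sum of edge lengths: \<open>w\<close> is below
  \<open>sin d * cos d\<close>, and \<open>tan d * sin d * cos d = (sin d)^2\<close>.\<close>

lemma tangent_segment_bounds: "0 \<le> tan (d m) * speed (m + d m)" "tan (d m) * speed (m + d m) \<le> 2 * \<kappa>"
proof -
  show "0 \<le> tan (d m) * speed (m + d m)"
    using tan_d_pos[of m] speed_pos[of "m + d m"] by simp
  have "tan (d m) * speed (m + d m) \<le> tan (d m) * (\<kappa> * (2 * (sin (d m) * cos (d m))))"
    unfolding speed_plus using w_bound[of m] \<kappa>_pos tan_d_pos[of m]
    by (intro mult_left_mono) (auto simp: mult.commute)
  also have "\<dots> = 2 * \<kappa> * (sin (d m))\<^sup>2"
    using cos_d_pos[of m] by (simp add: tan_def field_simps power2_eq_square)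
  also have "\<dots> \<le> 2 * \<kappa>"
    using \<kappa>_pos by (simp add: abs_square_le_1)
  finally show "tan (d m) * speed (m + d m) \<le> 2 * \<kappa>" .
qed

section \<open>Points of the table as intersections of tangents\<close>

lemma vertex_from_plus: "vertex m = caustic_point (m + d m) - tan (d m) *\<^sub>R caustic_tangent (m + d m)"
proof -
  \<comment> \<open>Expanding around the tangency angle and dividing by \<open>cos (d m)\<close>
    exhibits \<open>vertex m\<close> on the tangent with parameter
    \<open>- tan (d m)\<close>.\<close>
  have "cos m = cos ((m + d m) - d m)" "sin m = sin ((m + d m) - d m)"
    by simp_all
  then have "cos m = cos (m + d m) * cos (d m) + sin (m + d m) * sin (d m)"
    "sin m = sin (m + d m) * cos (d m) - cos (m + d m) * sin (d m)"
    unfolding cos_diff sin_diff by blast+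
  then have "cos m / cos (d m) = cos (m + d m) + tan (d m) * sin (m + d m)"
    "sin m / cos (d m) = sin (m + d m) - tan (d m) * cos (m + d m)"
    using cos_d_pos[of m] by (simp_all add: tan_def field_simps)
  note quotients = this
  show ?thesis
    unfolding vertex_def times_divide_eq_right[symmetric] quotients
    by (simp add: caustic_point_def caustic_tangent_def complex_eq_iff algebra_simps)
qed

lemma vertex_from_minus: "vertex m = caustic_point (m - d m) + tan (d m) *\<^sub>R caustic_tangent (m - d m)"
proof -
  have "cos m = cos ((m - d m) + d m)" "sin m = sin ((m - d m) + d m)"
    by simp_all
  then have "cos m = cos (m - d m) * cos (d m) - sin (m - d m) * sin (d m)"
    "sin m = sin (m - d m) * cos (d m) + cos (m - d m) * sin (d m)"
    unfolding cos_add sin_add by blast+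
  then have "cos m / cos (d m) = cos (m - d m) - tan (d m) * sin (m - d m)"
    "sin m / cos (d m) = sin (m - d m) + tan (d m) * cos (m - d m)"
    using cos_d_pos[of m] by (simp_all add: tan_def field_simps)
  note quotients = this
  show ?thesis
    unfolding vertex_def times_divide_eq_right[symmetric] quotients
    by (simp add: caustic_point_def caustic_tangent_def complex_eq_iff algebra_simps)
qed

lemma table_iff: "Complex (A * (r * cos m)) (B * (r * sin m)) \<in> confocal_ellipse a b 0 \<longleftrightarrow> r\<^sup>2 * g m = 1"
  by (simp add: confocal_ellipse_def g_def power_mult_distrib A_sq B_sq field_simps)

lemma vertex_in_table: "vertex m \<in> confocal_ellipse a b 0"
  using table_iff[of "1 / cos (d m)" m] cos_d_sq[of m] g_pos[of m]
  by (simp add: vertex_def power_divide)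

text \<open>For \<open>p = tan e\<close> the point has angle \<open>t + e\<close> and modulus
  \<open>1 / cos e\<close> in the coordinates that make the caustic a unit circle. Lying on the
  table fixes \<open>(cos e)^2\<close>, hence the absolute value of \<open>e\<close>; its sign tells
  on which side of the point of tangency the point lies.\<close>

lemma table_point_on_tangent:
  assumes "P \<in> confocal_ellipse a b 0" "P = caustic_point t + p *\<^sub>R caustic_tangent t"
  defines "e \<equiv> arctan p"
  shows "P = vertex (t + e)" and "\<bar>e\<bar> = d (t + e)"
proof -
  have ce: "cos e > 0" "- pi / 2 < e" "e < pi / 2" and p: "p = tan e"
    using arctan_bounded[of p] by (auto simp: e_def tan_arctan intro!: cos_gt_zero_pi)
  have "cos t - p * sin t = 1 / cos e * cos (t + e)" "sin t + p * cos t = 1 / cos e * sin (t + e)"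
    using ce by (simp_all add: p tan_def cos_add sin_add field_simps)
  moreover have "P = Complex (A * (cos t - p * sin t)) (B * (sin t + p * cos t))"
    using assms(2) by (auto simp: caustic_point_def caustic_tangent_def complex_eq_iff algebra_simps)
  ultimately have P: "P = Complex (A * (1 / cos e * cos (t + e))) (B * (1 / cos e * sin (t + e)))"
    by presburger
  then have "(1 / cos e)\<^sup>2 * g (t + e) = 1"
    using assms(1) table_iff by metis
  then have "(cos e)\<^sup>2 = g (t + e)"
    using ce by (simp add: field_simps)
  moreover from this have "e \<noteq> 0"
    using g_less_1[of "t + e"] by auto
  ultimately show e: "\<bar>e\<bar> = d (t + e)"
    using ce by (intro d_unique) auto
  then have "cos (d (t + e)) = cos e"
    by (metis cos_abs_real)
  then show "P = vertex (t + e)"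
    using P by (simp add: vertex_def)
qed

text \<open>In coordinates scaled by \<open>A\<close> and \<open>B\<close>, the polar coordinates of
  \<open>vertex m\<close> are \<open>1 / cos (d m)\<close> and \<open>m\<close>.\<close>

lemma vertex_eq_iff: "vertex m = vertex n \<longleftrightarrow> (\<exists>k::int. n = m + 2 * pi * of_int k)"
proof
  assume "vertex m = vertex n"
  then have eq: "cos m / cos (d m) = cos n / cos (d n)" "sin m / cos (d m) = sin n / cos (d n)"
    using A_pos B_pos by (simp_all add: vertex_def flip: times_divide_eq_right)
  then have "(cos m / cos (d m))\<^sup>2 + (sin m / cos (d m))\<^sup>2 = (cos n / cos (d n))\<^sup>2 + (sin n / cos (d n))\<^sup>2"
    by simp
  then have "1 / (cos (d m))\<^sup>2 = 1 / (cos (d n))\<^sup>2"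
    by (simp add: power_divide add_divide_distrib[symmetric])
  then have "cos (d m) = cos (d n)"
    using cos_d_pos[of m] cos_d_pos[of n] by (simp add: power2_eq_iff_nonneg)
  then have "sin n = sin m \<and> cos n = cos m"
    using eq cos_d_pos[of n] by simp
  then show "\<exists>k::int. n = m + 2 * pi * of_int k"
    by (simp add: sin_cos_eq_iff)
next
  assume "\<exists>k::int. n = m + 2 * pi * of_int k"
  then obtain k :: int where k: "n = m + 2 * pi * of_int k" by blast
  then have "sin n = sin m \<and> cos n = cos m"
    using sin_cos_eq_iff by blast
  then show "vertex m = vertex n"
    using g_shift[of m k] k by (simp add: vertex_def d_def)
qed

lemma table_point_is_vertex:
  assumes "P \<in> confocal_ellipse a b 0"
  shows "\<exists>m. P = vertex m"
proof -
  define Z where "Z = Complex (Re P / A) (Im P / B)"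
  define r m where "r = cmod Z" and "m = Arg Z"
  have "Z = rcis r m"
    by (simp add: r_def m_def rcis_cmod_Arg)
  then have "Re P / A = r * cos m" "Im P / B = r * sin m"
    by (simp_all add: Z_def complex_eq_iff)
  then have P: "P = Complex (A * (r * cos m)) (B * (r * sin m))"
    using A_pos B_pos by (simp add: complex_eq_iff field_simps)
  then have "r\<^sup>2 * g m = 1"
    using assms table_iff by blast
  then have "r\<^sup>2 = (1 / cos (d m))\<^sup>2"
    using cos_d_sq[of m] g_pos[of m] by (simp add: power_divide field_simps)
  moreover have "r \<ge> 0"
    by (simp add: r_def)
  ultimately have "r = 1 / cos (d m)"
    using cos_d_pos[of m] by (simp add: power2_eq_iff_nonneg)
  then show ?thesis
    using P by (auto simp: vertex_def)
qed

section \<open>Edges tangent to the caustic\<close>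

lemma caustic_point_in_caustic: "caustic_point t \<in> confocal_ellipse a b l"
  using A_pos B_pos by (simp add: caustic_point_def confocal_ellipse_def power_mult_distrib A_sq[symmetric] B_sq[symmetric])

lemma caustic_point_exists:
  assumes "T \<in> confocal_ellipse a b l"
  shows "\<exists>t. T = caustic_point t"
proof -
  have "(Re T / A)\<^sup>2 + (Im T / B)\<^sup>2 = 1"
    using assms by (simp add: confocal_ellipse_def power_divide A_sq B_sq)
  then obtain t where "Re T / A = cos t" "Im T / B = sin t"
    by (metis sincos_total_2pi)
  then show ?thesis
    using A_pos B_pos by (auto simp: caustic_point_def complex_eq_iff field_simps)
qed

lemma rotated_normal_caustic_point:
  "\<i> * ellipse_normal a b l (caustic_point t) = (1 / (A * B)) *\<^sub>R caustic_tangent t"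
  using A_pos B_pos unfolding ellipse_normal_def A_sq[symmetric] B_sq[symmetric]
  by (simp add: caustic_point_def caustic_tangent_def complex_eq_iff power2_eq_square)

text \<open>The form \<open>q\<close> of the table is 1 at both ends and less than 1 on the caustic,
  so its convexity defect \<open>v * (1 - v) * q (X - Y)\<close> is positive. Since
  \<open>tangent_ccw\<close> only puts the tangency point on the full line, this is what places it
  inside the chord.\<close>

lemma convex_combination_in_table:
  assumes X: "X \<in> confocal_ellipse a b 0" and Y: "Y \<in> confocal_ellipse a b 0" and "X \<noteq> Y"
    and T: "T \<in> confocal_ellipse a b l" "T = (1 - v) *\<^sub>R X + v *\<^sub>R Y"
  shows "0 < v" "v < 1"
proof -
  define q where "q Z = (Re Z)\<^sup>2 / a\<^sup>2 + (Im Z)\<^sup>2 / b\<^sup>2" for Z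
  have conv: "((1 - v) * x + v * y)\<^sup>2 = (1 - v) * x\<^sup>2 + v * y\<^sup>2 - v * (1 - v) * (x - y)\<^sup>2" for x y :: real
    by algebra
  have "q X = 1" "q Y = 1"
    using X Y by (simp_all add: q_def confocal_ellipse_def)
  moreover have "q T = (1 - v) * q X + v * q Y - v * (1 - v) * q (X - Y)"
    by (simp add: T(2) q_def conv add_divide_distrib diff_divide_distrib distrib_left)
  ultimately have *: "v * (1 - v) * q (X - Y) = 1 - q T"
    by simp
  obtain t where t: "T = caustic_point t"
    using T(1) caustic_point_exists by blast
  have "q T = g t"
    by (simp add: t q_def caustic_point_def g_def power_mult_distrib A_sq B_sq)
  then have "v * (1 - v) * q (X - Y) > 0"
    using * g_less_1[of t] by simp
  moreover have "q (X - Y) \<ge> 0"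
    by (simp add: q_def)
  ultimately have "v * (1 - v) > 0"
    by (simp add: zero_less_mult_iff)
  then show "0 < v" "v < 1"
    by (auto simp: zero_less_mult_iff)
qed

text \<open>The tangency point lies inside the edge and the edge points along the caustic tangent,
  so the start has a negative and the end a positive tangent parameter.\<close>

lemma tangent_step:
  assumes X: "vertex m \<noteq> Y" and Y: "Y \<in> confocal_ellipse a b 0" and tan: "tangent_ccw a b l (vertex m) Y"
  shows "\<exists>n. Y = vertex n \<and> n - d n = m + d m"
proof -
  let ?X = "vertex m"
  obtain T s where T: "T \<in> confocal_ellipse a b l" "T \<in> affine hull {?X, Y}"
    and s: "s > 0" "Y - ?X = s *\<^sub>R (\<i> * ellipse_normal a b l T)"
    using tan unfolding tangent_ccw_def by blast
  obtain u v where uv: "T = u *\<^sub>R ?X + v *\<^sub>R Y" "u + v = 1"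
    using T(2) by (auto simp: affine_hull_2)
  then have Tv: "T = (1 - v) *\<^sub>R ?X + v *\<^sub>R Y"
    by (metis add_diff_cancel_right')
  note v = convex_combination_in_table[OF vertex_in_table Y X T(1) Tv]
  obtain t where t: "T = caustic_point t"
    using T(1) caustic_point_exists by blast
  define r where "r = s / (A * B)"
  have r: "r > 0" "Y - ?X = r *\<^sub>R caustic_tangent t"
    using s A_pos B_pos by (auto simp: r_def t rotated_normal_caustic_point)
  have "?X = T - v *\<^sub>R (Y - ?X)" "Y = T + (1 - v) *\<^sub>R (Y - ?X)"
    by (simp_all add: Tv algebra_simps)
  then have X': "?X = caustic_point t + (- (v * r)) *\<^sub>R caustic_tangent t"
    and Y': "Y = caustic_point t + ((1 - v) * r) *\<^sub>R caustic_tangent t"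
    using r t by simp_all
  define e where "e = arctan (v * r)"
  define e' where "e' = arctan ((1 - v) * r)"
  have e: "e > 0" "e' > 0"
    using v r by (auto simp: e_def e'_def)
  have "?X = vertex (t - e)" "e = d (t - e)"
    using table_point_on_tangent[OF vertex_in_table X'] e by (auto simp: e_def arctan_minus)
  moreover have "Y = vertex (t + e')" "e' = d (t + e')"
    using table_point_on_tangent[OF Y Y'] e by (auto simp: e'_def)
  moreover obtain k :: int where k: "t - e = m + 2 * pi * of_int k"
    using vertex_eq_iff[of m "t - e"] \<open>?X = vertex (t - e)\<close> by auto
  moreover have shift: "d (x + 2 * pi * of_int j) = d x" for x j
    by (simp add: d_def g_shift)
  \<comment> \<open>The starting point determines \<open>t - e\<close> only modulo
    \<open>2 * pi\<close>; removing the same multiple from the angle of \<open>Y\<close> makes the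
    two tangency angles equal as reals.\<close>
  define n where "n = t + e' + 2 * pi * of_int (- k)"
  have "vertex (t + e') = vertex n"
    using vertex_eq_iff n_def by blast
  moreover have "d n = d (t + e')" "d (t - e) = d m"
    unfolding n_def k shift by simp_all
  ultimately show ?thesis
    by (intro exI[of _ n]) (simp add: n_def)
qed

lemma circumscribing_trajectory_vertices:
  assumes "circumscribing_trajectory a b l P"
  shows "\<exists>m. \<forall>i. P i = vertex (m i) \<and> m (Suc i) - d (m (Suc i)) = m i + d (m i)"
proof -
  have P: "P i \<in> confocal_ellipse a b 0" "P i \<noteq> P (Suc i)" "tangent_ccw a b l (P i) (P (Suc i))" for i
    using assms by (auto simp: circumscribing_trajectory_def billiard_trajectory_def)
  show ?thesis
  proof (rule dependent_nat_choice)
    show "\<exists>x. P 0 = vertex x"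
      by (rule table_point_is_vertex[OF P(1)])
    show "\<exists>y. P (Suc i) = vertex y \<and> y - d y = x + d x" if "P i = vertex x" for x i
      using tangent_step[of x "P (Suc i)"] P(1)[of "Suc i"] P(2)[of i] P(3)[of i] that by auto
  qed
qed

section \<open>Trajectories circumscribing the caustic\<close>

text \<open>Consecutive vertices share a tangent. The equation is between real lifts, not modulo
  \<open>2 * pi\<close>, so \<open>m\<close> also counts the turns around the centre.\<close>

definition "vertex_chain m \<longleftrightarrow> (\<forall>i::nat. m (Suc i) - d (m (Suc i)) = m i + d (m i))"

lemma vertex_chainD: "vertex_chain m \<Longrightarrow> m (Suc i) - d (m (Suc i)) = m i + d (m i)"
  by (simp add: vertex_chain_def)

text \<open>Supplies a trajectory, without which the limits in the definite descriptions would not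
  be unique. As \<open>d\<close> lies between 0 and \<open>pi / 2\<close>, the intermediate value
  theorem inverts \<open>n - d n\<close>.\<close>

lemma vertex_chain_exists: "\<exists>m. vertex_chain m"
proof -
  have "\<exists>n. n - d n = y" for y
  proof -
    have "isCont (\<lambda>n. n - d n) x" for x
      using deriv_minus by (rule DERIV_isCont)
    then have "\<exists>n\<ge>y. n \<le> y + pi / 2 \<and> n - d n = y"
      using d_pos[of y] d_less[of "y + pi / 2"] by (intro IVT) auto
    then show ?thesis by blast
  qed
  then have "\<exists>m. \<forall>i. True \<and> m (Suc i) - d (m (Suc i)) = m i + d (m i)"
    by (intro dependent_nat_choice) auto
  then show ?thesis
    by (auto simp: vertex_chain_def)
qed

section \<open>Edges of a vertex chain and the reflection law\<close>

lemma edge_vector: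
  assumes "n - d n = m + d m"
  shows "vertex n - vertex m = (tan (d m) + tan (d n)) *\<^sub>R caustic_tangent (m + d m)"
  unfolding vertex_from_minus[of n] vertex_from_plus[of m] assms
  by (simp add: algebra_simps)

lemma edge_length:
  assumes "n - d n = m + d m"
  shows "dist (vertex m) (vertex n) = tan (d m) * speed (m + d m) + tan (d n) * speed (n - d n)"
proof -
  have "dist (vertex m) (vertex n) = norm (vertex n - vertex m)"
    by (simp add: dist_norm norm_minus_commute)
  also have "\<dots> = (tan (d m) + tan (d n)) * speed (m + d m)"
    using tan_d_pos[of m] tan_d_pos[of n] by (simp add: edge_vector[OF assms] norm_caustic_tangent)
  finally show ?thesis
    by (simp add: assms distrib_right)
qed

lemma edge_direction:
  assumes "n - d n = m + d m"
  shows "sgn (vertex n - vertex m) = (1 / speed (m + d m)) *\<^sub>R caustic_tangent (m + d m)"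
proof -
  have "tan (d m) + tan (d n) > 0"
    using tan_d_pos[of m] tan_d_pos[of n] by simp
  then show ?thesis
    unfolding edge_vector[OF assms]
    by (simp add: sgn_scaleR sgn_div_norm[of "caustic_tangent _"] norm_caustic_tangent inverse_eq_divide)
qed

lemma edge_tangent_ccw:
  assumes "n - d n = m + d m"
  shows "tangent_ccw a b l (vertex m) (vertex n)"
proof -
  define x y where "x = tan (d m)" and "y = tan (d n)"
  have xy: "x > 0" "y > 0"
    by (simp_all add: x_def y_def tan_d_pos)
  let ?T = "caustic_point (m + d m)"
  have "?T = vertex m + x *\<^sub>R caustic_tangent (m + d m)"
    by (simp add: vertex_from_plus x_def)
  also have "\<dots> = vertex m + (x / (x + y)) *\<^sub>R (vertex n - vertex m)"
    using xy by (simp add: edge_vector[OF assms] x_def[symmetric] y_def[symmetric])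
  finally have "?T = (1 - x / (x + y)) *\<^sub>R vertex m + (x / (x + y)) *\<^sub>R vertex n"
    by (simp add: algebra_simps)
  then have "?T \<in> affine hull {vertex m, vertex n}"
    unfolding affine_hull_2 mem_Collect_eq
    by (intro exI[of _ "1 - x / (x + y)"] exI[of _ "x / (x + y)"]) simp
  moreover have "vertex n - vertex m = ((x + y) * (A * B)) *\<^sub>R (\<i> * ellipse_normal a b l ?T)"
    unfolding rotated_normal_caustic_point edge_vector[OF assms] x_def y_def
    using A_pos B_pos by simp
  moreover have "(x + y) * (A * B) > 0"
    using xy A_pos B_pos by simp
  ultimately show ?thesis
    unfolding tangent_ccw_def using caustic_point_in_caustic by blast
qed

lemma reflection_at_vertex:
  "reflect (ellipse_normal a b 0 (vertex m)) ((1 / speed (m - d m)) *\<^sub>R caustic_tangent (m - d m))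
    = (1 / speed (m + d m)) *\<^sub>R caustic_tangent (m + d m)"
proof (rule reflect_eqI)
  define sm cm sd cd where "sm = sin m" and "cm = cos m" and "sd = sin (d m)" and "cd = cos (d m)"
  note defs = sm_def[symmetric] cm_def[symmetric] sd_def[symmetric] cd_def[symmetric]
  define q where "q = l * (a\<^sup>2 - b\<^sup>2) / (a\<^sup>2 * b\<^sup>2)"
  define W where "W = w m"
  have W: "W = q * sm * cm"
    by (simp add: W_def w_def q_def sm_def cm_def)
  define u v where "u = sd * cd + W" and "v = sd * cd - W"
  have uv: "u > 0" "v > 0" and cd: "cd > 0"
    using w_bounds[of m] cos_d_pos[of m] by (simp_all add: u_def v_def W_def sd_def cd_def)
  \<comment> \<open>Read off from \<open>re\<close> and \<open>im\<close>: over the common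
    denominator \<open>\<kappa> * (u * v)\<close> the components of the difference of unit
    directions are \<open>2 * cd\<close> times those of the normal direction, by \<open>qa\<close>
    and \<open>qb\<close>.\<close>
  define \<mu> where "\<mu> = 2 * cd\<^sup>2 * l / (\<kappa> * (u * v))"
  have qa: "sd\<^sup>2 - q * sm\<^sup>2 = l / a\<^sup>2"
    using a0 by (simp add: sd_def sm_def sin_d_sq g_alt q_def diff_divide_distrib)
  have "q = l / b\<^sup>2 - l / a\<^sup>2"
    using a0 b0 by (simp add: q_def field_simps)
  moreover have "sm\<^sup>2 + cm\<^sup>2 = 1"
    by (simp add: sm_def cm_def)
  ultimately have qb: "sd\<^sup>2 + q * cm\<^sup>2 = l / b\<^sup>2"
    using qa by algebra
  have re: "v * (sm * cd + cm * sd) - u * (sm * cd - cm * sd) = 2 * cd * (l / a\<^sup>2 * cm)"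
    unfolding u_def v_def W qa[symmetric] by algebra
  have im: "u * (cm * cd + sm * sd) - v * (cm * cd - sm * sd) = 2 * cd * (l / b\<^sup>2 * sm)"
    unfolding u_def v_def W qb[symmetric] by algebra
  have sp: "speed (m + d m) = \<kappa> * u" "speed (m - d m) = \<kappa> * v"
    by (simp_all add: speed_tangency u_def v_def W_def sd_def cd_def)
  show "(1 / speed (m - d m)) *\<^sub>R caustic_tangent (m - d m) - (1 / speed (m + d m)) *\<^sub>R caustic_tangent (m + d m)
    = \<mu> *\<^sub>R ellipse_normal a b 0 (vertex m)"
  proof (rule complex_eqI)
    have "- A * (sm * cd - cm * sd) / (\<kappa> * v) + A * (sm * cd + cm * sd) / (\<kappa> * u)
       = A * (v * (sm * cd + cm * sd) - u * (sm * cd - cm * sd)) / (\<kappa> * (u * v))"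
      using uv \<kappa>_pos by (simp add: field_simps)
    also have "\<dots> = \<mu> * (A * cm / cd / a\<^sup>2)"
      unfolding re \<mu>_def using cd by (simp add: power2_eq_square mult_ac)
    finally show "Re ((1 / speed (m - d m)) *\<^sub>R caustic_tangent (m - d m) - (1 / speed (m + d m)) *\<^sub>R caustic_tangent (m + d m))
      = Re (\<mu> *\<^sub>R ellipse_normal a b 0 (vertex m))"
      by (simp add: sp caustic_tangent_def ellipse_normal_def vertex_def sin_add sin_diff defs)
    have "B * (cm * cd + sm * sd) / (\<kappa> * v) - B * (cm * cd - sm * sd) / (\<kappa> * u)
       = B * (u * (cm * cd + sm * sd) - v * (cm * cd - sm * sd)) / (\<kappa> * (u * v))"
      using uv \<kappa>_pos by (simp add: field_simps)
    also have "\<dots> = \<mu> * (B * sm / cd / b\<^sup>2)"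
      unfolding im \<mu>_def using cd by (simp add: power2_eq_square mult_ac)
    finally show "Im ((1 / speed (m - d m)) *\<^sub>R caustic_tangent (m - d m) - (1 / speed (m + d m)) *\<^sub>R caustic_tangent (m + d m))
      = Im (\<mu> *\<^sub>R ellipse_normal a b 0 (vertex m))"
      by (simp add: sp caustic_tangent_def ellipse_normal_def vertex_def cos_add cos_diff defs)
  qed
  show "\<mu> \<noteq> 0"
    using uv cd l0 \<kappa>_pos by (simp add: \<mu>_def)
  show "norm ((1 / speed (m - d m)) *\<^sub>R caustic_tangent (m - d m)) = norm ((1 / speed (m + d m)) *\<^sub>R caustic_tangent (m + d m))"
    using speed_pos[of "m - d m"] speed_pos[of "m + d m"] by (simp add: norm_caustic_tangent)
qed

lemma circumscribing_trajectory_iff: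
  "circumscribing_trajectory a b l P \<longleftrightarrow> (\<exists>m. vertex_chain m \<and> P = (\<lambda>i. vertex (m i)))"
proof
  assume "circumscribing_trajectory a b l P"
  from circumscribing_trajectory_vertices[OF this]
  show "\<exists>m. vertex_chain m \<and> P = (\<lambda>i. vertex (m i))"
    unfolding vertex_chain_def fun_eq_iff by auto
next
  assume "\<exists>m. vertex_chain m \<and> P = (\<lambda>i. vertex (m i))"
  then obtain m where m: "vertex_chain m" and P: "P = (\<lambda>i. vertex (m i))"
    by blast
  have "dist (P i) (P (Suc i)) > 0" for i
    unfolding P edge_length[OF vertex_chainD[OF m]]
    using speed_pos tan_d_pos by (intro add_pos_pos mult_pos_pos)
  then have "P i \<noteq> P (Suc i)" for i
    by (simp add: zero_less_dist_iff)
  moreover have "sgn (P (Suc (Suc i)) - P (Suc i)) =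
      reflect (ellipse_normal a b 0 (P (Suc i))) (sgn (P (Suc i) - P i))" for i
    unfolding P edge_direction[OF vertex_chainD[OF m]]
    using reflection_at_vertex[of "m (Suc i)"] vertex_chainD[OF m, of i] by simp
  ultimately show "circumscribing_trajectory a b l P"
    unfolding circumscribing_trajectory_def billiard_trajectory_def
    using vertex_in_table edge_tangent_ccw[OF vertex_chainD[OF m]] by (auto simp: P)
qed

section \<open>Polar angles compared with eccentric angles\<close>

lemma cos_polar_angle_vertex:
  assumes "vertex m = cmod (vertex m) * cis \<theta>"
  shows "cos (\<theta> - m) > 0"
proof -
  define r where "r = cmod (vertex m)"
  have "vertex m = r * cis \<theta>"
    using assms by (simp add: r_def)
  then have eq: "A * cos m / cos (d m) = r * cos \<theta>" "B * sin m / cos (d m) = r * sin \<theta>"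
    by (simp_all add: vertex_def complex_eq_iff)
  \<comment> \<open>The scalar product of \<open>vertex m\<close> with \<open>cis m\<close>.\<close>
  have "r * cos (\<theta> - m) = (r * cos \<theta>) * cos m + (r * sin \<theta>) * sin m"
    by (simp add: cos_diff algebra_simps)
  also have "\<dots> = (A * (cos m)\<^sup>2 + B * (sin m)\<^sup>2) / cos (d m)"
    unfolding eq[symmetric] by (simp add: power2_eq_square add_divide_distrib)
  also have "\<dots> > 0"
  proof -
    have "0 < min A B * ((cos m)\<^sup>2 + (sin m)\<^sup>2)"
      using A_pos B_pos by simp
    also have "\<dots> \<le> A * (cos m)\<^sup>2 + B * (sin m)\<^sup>2"
      unfolding distrib_left by (intro add_mono mult_right_mono) auto
    finally show ?thesis
      using cos_d_pos[of m] by simp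
  qed
  finally have "r * cos (\<theta> - m) > 0" .
  moreover have "r \<ge> 0"
    by (simp add: r_def)
  ultimately show ?thesis
    by (simp add: zero_less_mult_iff)
qed

lemma sin_polar_angle_edge:
  assumes n: "n - d n = m + d m"
    and \<theta>: "vertex m = cmod (vertex m) * cis \<theta>" and \<eta>: "vertex n = cmod (vertex n) * cis \<eta>"
  shows "sin (\<eta> - \<theta>) > 0"
proof -
  define r s where "r = cmod (vertex m)" and "s = cmod (vertex n)"
  have "vertex m = r * cis \<theta>" "vertex n = s * cis \<eta>"
    using \<theta> \<eta> by (simp_all add: r_def s_def)
  then have eq: "A * cos m / cos (d m) = r * cos \<theta>" "B * sin m / cos (d m) = r * sin \<theta>"
      "A * cos n / cos (d n) = s * cos \<eta>" "B * sin n / cos (d n) = s * sin \<eta>"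
    by (simp_all add: vertex_def complex_eq_iff)
  \<comment> \<open>The cross product of the two vertices. Scaling the axes by \<open>A\<close> and
    \<open>B\<close> preserves its sign, and \<open>n - m = d m + d n\<close> lies between 0 and
    \<open>pi\<close>.\<close>
  have "r * s * sin (\<eta> - \<theta>) = (s * sin \<eta>) * (r * cos \<theta>) - (s * cos \<eta>) * (r * sin \<theta>)"
    by (simp add: sin_diff algebra_simps)
  also have "\<dots> = A * B * sin (n - m) / (cos (d m) * cos (d n))"
    unfolding eq[symmetric] using cos_d_pos[of m] cos_d_pos[of n] by (simp add: sin_diff field_simps)
  also have "\<dots> > 0"
  proof -
    have "0 < n - m" "n - m < pi"
      using n d_pos[of m] d_pos[of n] d_less[of m] d_less[of n] by linarith+
    then have "sin (n - m) > 0"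
      by (rule sin_gt_zero)
    then show ?thesis
      using A_pos B_pos cos_d_pos by simp
  qed
  finally have "r * s * sin (\<eta> - \<theta>) > 0" .
  moreover have "r * s \<ge> 0"
    by (simp add: r_def s_def)
  ultimately show ?thesis
    by (simp add: zero_less_mult_iff)
qed

lemma lifted_polar_angle_exists:
  assumes m: "vertex_chain m"
  shows "\<exists>\<theta>. lifted_polar_angle (\<lambda>i. vertex (m i)) \<theta>"
proof -
  define \<epsilon> where "\<epsilon> i = Arg (vertex (m i) * cis (- m i))" for i
  define \<theta> where "\<theta> i = m i + \<epsilon> i" for i
  have polar: "vertex (m i) = cmod (vertex (m i)) * cis (\<theta> i)" for i
  proof -
    have "cmod (vertex (m i) * cis (- m i)) * cis (\<epsilon> i) = vertex (m i) * cis (- m i)"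
      unfolding \<epsilon>_def by (metis rcis_cmod_Arg rcis_def)
    then have "cmod (vertex (m i)) * cis (\<epsilon> i) * cis (m i) = vertex (m i) * (cis (- m i) * cis (m i))"
      by (simp add: norm_mult)
    then show ?thesis
      by (simp add: \<theta>_def cis_mult mult.assoc add.commute)
  qed
  have \<epsilon>: "\<bar>\<epsilon> i\<bar> < pi / 2" for i
    using cos_polar_angle_vertex[OF polar[of i]] Arg_bounded[of "vertex (m i) * cis (- m i)"] pi_gt_zero
    by (intro abs_less_pi_half_if_cos_pos) (auto simp: \<theta>_def \<epsilon>_def[symmetric] abs_less_iff)
  have "0 < \<theta> (Suc i) - \<theta> i" "\<theta> (Suc i) - \<theta> i < 2 * pi" for i
  proof -
    have step: "0 < m (Suc i) - m i" "m (Suc i) - m i < pi"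
      using vertex_chainD[OF m, of i] d_pos[of "m i"] d_pos[of "m (Suc i)"] d_less[of "m i"] d_less[of "m (Suc i)"]
      by linarith+
    then show "\<theta> (Suc i) - \<theta> i < 2 * pi"
      using \<epsilon>[of i] \<epsilon>[of "Suc i"] unfolding \<theta>_def by linarith
    have "sin (\<theta> (Suc i) - \<theta> i) > 0"
      by (rule sin_polar_angle_edge[OF vertex_chainD[OF m] polar polar])
    \<comment> \<open>The increment exceeds \<open>- pi\<close>; if it were not positive, its sine
      could not be positive.\<close>
    moreover have "\<theta> i - \<theta> (Suc i) \<le> pi"
      using step \<epsilon>[of i] \<epsilon>[of "Suc i"] unfolding \<theta>_def by linarith
    moreover have "sin (\<theta> i - \<theta> (Suc i)) = - sin (\<theta> (Suc i) - \<theta> i)"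
      using sin_minus[of "\<theta> (Suc i) - \<theta> i"] by (simp only: minus_diff_eq)
    ultimately show "0 < \<theta> (Suc i) - \<theta> i"
      using sin_ge_zero[of "\<theta> i - \<theta> (Suc i)"] by linarith
  qed
  then show ?thesis
    unfolding lifted_polar_angle_def using polar by blast
qed

text \<open>A lift may a priori advance by nearly a full turn. The positive sine limits each
  increment to less than \<open>pi\<close>, so the distance from the shifted chain stays below
  \<open>3 * pi / 2\<close> after a step, and the positive cosine brings it back below
  \<open>pi / 2\<close>.\<close>

lemma lifted_polar_angle_near_chain:
  assumes m: "vertex_chain m" and \<theta>: "lifted_polar_angle (\<lambda>i. vertex (m i)) \<theta>"
  shows "\<exists>k::int. \<forall>i. \<bar>\<theta> i - m i - 2 * pi * of_int k\<bar> < pi / 2"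
proof -
  have polar: "vertex (m i) = cmod (vertex (m i)) * cis (\<theta> i)"
    and inc: "0 < \<theta> (Suc i) - \<theta> i" "\<theta> (Suc i) - \<theta> i < 2 * pi" for i
    using \<theta> by (simp_all add: lifted_polar_angle_def)
  have cos_pos: "cos (\<theta> i - m i) > 0" for i
    by (rule cos_polar_angle_vertex[OF polar])
  obtain k :: int where k: "\<bar>\<theta> 0 - m 0 - 2 * pi * of_int k\<bar> < pi / 2"
    using cos_pos_imp_near_multiple[OF cos_pos] by blast
  have "\<bar>\<theta> i - m i - 2 * pi * of_int k\<bar> < pi / 2" for i
  proof (induction i)
    case (Suc i)
    have "\<theta> (Suc i) - \<theta> i < pi"
      using sin_polar_angle_edge[OF vertex_chainD[OF m] polar polar, of i] inc[of i]
        sin_le_zero[of "\<theta> (Suc i) - \<theta> i"] by linarith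
    moreover have "0 < m (Suc i) - m i" "m (Suc i) - m i < pi"
      using vertex_chainD[OF m, of i] d_pos[of "m i"] d_pos[of "m (Suc i)"] d_less[of "m i"] d_less[of "m (Suc i)"]
      by linarith+
    ultimately have "\<bar>\<theta> (Suc i) - m (Suc i) - 2 * pi * of_int k\<bar> < 3 * pi / 2"
      using Suc inc(1)[of i] by linarith
    moreover have "cos (\<theta> (Suc i) - m (Suc i) - 2 * pi * of_int k) > 0"
      using cos_pos[of "Suc i"] by (simp only: cos_diff_multiple_two_pi)
    ultimately show ?case
      by (intro abs_less_pi_half_if_cos_pos)
  qed (rule k)
  then show ?thesis
    by blast
qed

section \<open>Rotation number and mean edge length\<close>

text \<open>The half-angle at the vertex on the minor axis. The arctangent suits the substitution in
  \<open>inner_time_eq\<close>; the arcsine form is the amplitude of the elliptic integral.\<close>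

definition "touch_angle = arctan (sqrt l / B)"

lemma d_pi_half: "d (pi / 2) = touch_angle" and touch_angle_eq_arcsin: "touch_angle = arcsin (sqrt l / b)" and sin_touch_angle: "sin touch_angle = sqrt l / b"
  and touch_angle_pos: "0 < touch_angle" and touch_angle_less: "touch_angle < pi / 2"
proof -
  have pos: "sqrt l / B > 0"
    using l0 B_pos by simp
  then show bounds: "0 < touch_angle" "touch_angle < pi / 2"
    using arctan_bounded[of "sqrt l / B"] by (auto simp: touch_angle_def)
  have "b\<^sup>2 = B\<^sup>2 + l"
    by (simp add: B_sq)
  then have "1 + (sqrt l / B)\<^sup>2 = b\<^sup>2 / B\<^sup>2"
    using B_pos l0 by (simp add: power_divide add_divide_distrib)
  then have sq: "sqrt (1 + (sqrt l / B)\<^sup>2) = b / B"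
    using B_pos b0 by (simp add: real_sqrt_divide)
  show s: "sin touch_angle = sqrt l / b"
    unfolding touch_angle_def sin_arctan sq using B_pos by simp
  show "touch_angle = arcsin (sqrt l / b)"
    unfolding s[symmetric] using bounds by (intro arcsin_sin[symmetric]) auto
  have "cos touch_angle = B / b"
    unfolding touch_angle_def cos_arctan sq using B_pos by simp
  then have "(cos touch_angle)\<^sup>2 = g (pi / 2)"
    by (simp add: g_def power_divide B_sq)
  then show "d (pi / 2) = touch_angle"
    using d_unique bounds by simp
qed

section \<open>Arc length, invariant time and the rotation number\<close>

lemma speed_antiderivative_exists: "\<exists>S. \<forall>t. (S has_real_derivative speed t) (at t)"
  unfolding speed_def by (intro antiderivative_exists continuous_intros)

lemma inverse_speed_antiderivative_exists: "\<exists>H. \<forall>t. (H has_real_derivative 1 / speed t) (at t)"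
proof (intro antiderivative_exists continuous_intros)
  show "continuous_on UNIV speed"
    unfolding speed_def[abs_def] by (intro continuous_intros)
  show "\<forall>x\<in>UNIV. speed x \<noteq> 0"
    using speed_pos by (metis less_irrefl)
qed

lemma sin_sq_antiderivative_speed:
  assumes "\<And>t. (S has_real_derivative speed t) (at t)"
  shows "sin_sq_antiderivative S (\<lambda>x. sqrt (b\<^sup>2 - l + (a\<^sup>2 - b\<^sup>2) * x))"
  using assms by unfold_locales (simp add: speed_def)

lemma sin_sq_antiderivative_inverse_speed:
  assumes "\<And>t. (H has_real_derivative 1 / speed t) (at t)"
  shows "sin_sq_antiderivative H (\<lambda>x. 1 / sqrt (b\<^sup>2 - l + (a\<^sup>2 - b\<^sup>2) * x))"
  using assms by unfold_locales (simp add: speed_def)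

text \<open>Every reflection advances \<open>H\<close> by the same \<open>C\<close>, while
  \<open>H\<close> grows by \<open>V\<close> per angle \<open>pi\<close>. The mean advance is
  therefore \<open>C / (2 * V)\<close> turns.\<close>

lemma tangency_growth:
  assumes m: "vertex_chain m" and H: "\<And>t. (H has_real_derivative 1 / speed t) (at t)"
  defines "R \<equiv> (H (pi / 2 + touch_angle) - H (pi / 2)) / (2 * (H pi - H (pi / 2)))"
  shows "\<exists>K. \<forall>N. \<bar>((m N + d (m N)) - (m 0 + d (m 0))) / (2 * pi) - real N * R\<bar> \<le> K"
proof -
  interpret sin_sq_antiderivative H "\<lambda>x. 1 / sqrt (b\<^sup>2 - l + (a\<^sup>2 - b\<^sup>2) * x)"
    by (rule sin_sq_antiderivative_inverse_speed[OF H])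
  define V where "V = 2 * (H pi - H (pi / 2))"
  define C where "C = 2 * (H (pi / 2 + touch_angle) - H (pi / 2))"
  define \<tau> where "\<tau> i = m i + d (m i)" for i
  have "H (pi / 2) < H pi"
    using pi_gt_zero by (intro DERIV_pos_imp_increasing[where f = H]) (auto intro!: H exI speed_pos divide_pos_pos)
  then have V: "V > 0"
    by (simp add: V_def)
  have "C = H (pi / 2 + d (pi / 2)) - H (pi / 2 - d (pi / 2))"
    using reflect_pi_half[of touch_angle] by (simp add: C_def d_pi_half)
  then have "H (\<tau> (Suc i)) - H (\<tau> i) = C" for i
    using time_between_tangencies_const[OF H, of "m (Suc i)" "pi / 2"] vertex_chainD[OF m, of i]
    by (simp add: \<tau>_def)
  then have H\<tau>: "H (\<tau> N) - H (\<tau> 0) = real N * C" for N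
  proof (induction N)
    case (Suc N)
    then have "H (\<tau> N) - H (\<tau> 0) = real N * C" "H (\<tau> (Suc N)) - H (\<tau> N) = C"
      by blast+
    then show ?case
      by (simp add: algebra_simps)
  qed simp
  obtain K where K: "\<And>t. \<bar>H t - t / pi * V\<bar> \<le> K"
    using linear_growth unfolding V_def by blast
  have "\<bar>(\<tau> N - \<tau> 0) / (2 * pi) - real N * R\<bar> \<le> K / V" for N
  proof -
    have "(\<tau> N - \<tau> 0) / pi * V - real N * C = (H (\<tau> 0) - \<tau> 0 / pi * V) - (H (\<tau> N) - \<tau> N / pi * V)"
      using H\<tau>[of N] by (simp add: diff_divide_distrib algebra_simps)
    also have "\<bar>\<dots>\<bar> \<le> \<bar>H (\<tau> 0) - \<tau> 0 / pi * V\<bar> + \<bar>H (\<tau> N) - \<tau> N / pi * V\<bar>"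
      by (rule abs_triangle_ineq4)
    also have "\<dots> \<le> K + K"
      by (intro add_mono K)
    finally have "\<bar>(\<tau> N - \<tau> 0) / pi * V - real N * C\<bar> \<le> 2 * K"
      by simp
    moreover have "R = C / (2 * V)"
      unfolding R_def C_def V_def by (simp only: mult_divide_mult_cancel_left_if) simp
    then have "(\<tau> N - \<tau> 0) / (2 * pi) - real N * R = ((\<tau> N - \<tau> 0) / pi * V - real N * C) / (2 * V)"
      using V by (simp add: diff_divide_distrib)
    ultimately show ?thesis
      using V by (simp add: abs_divide divide_le_eq mult.commute)
  qed
  then show ?thesis
    unfolding \<tau>_def by blast
qed

lemma rotation_number_eq:
  assumes H: "\<And>t. (H has_real_derivative 1 / speed t) (at t)"
  shows "rotation_number a b l = (H (pi / 2 + touch_angle) - H (pi / 2)) / (2 * (H pi - H (pi / 2)))" (is "_ = ?R")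
  unfolding rotation_number_def
proof (rule the_equality)
  show lim: "\<forall>P \<theta>. circumscribing_trajectory a b l P \<and> lifted_polar_angle P \<theta> \<longrightarrow>
    (\<lambda>N. (\<theta> N - \<theta> 0) / (2 * pi * real N)) \<longlonglongrightarrow> ?R"
  proof (intro allI impI, elim conjE)
    fix P \<theta>
    assume "circumscribing_trajectory a b l P" and \<theta>: "lifted_polar_angle P \<theta>"
    then obtain m where m: "vertex_chain m" and P: "P = (\<lambda>i. vertex (m i))"
      unfolding circumscribing_trajectory_iff by blast
    obtain k :: int where k: "\<And>i. \<bar>\<theta> i - m i - 2 * pi * of_int k\<bar> < pi / 2"
      using lifted_polar_angle_near_chain[OF m \<theta>[unfolded P]] by blast
    obtain K where K: "\<And>N. \<bar>((m N + d (m N)) - (m 0 + d (m 0))) / (2 * pi) - real N * ?R\<bar> \<le> K"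
      using tangency_growth[OF m H] by blast
    have "\<bar>(\<theta> N - \<theta> 0) / (2 * pi) - real N * ?R\<bar> \<le> K + 1" for N
    proof -
      have "\<bar>(\<theta> N - \<theta> 0) - ((m N + d (m N)) - (m 0 + d (m 0)))\<bar> \<le> 2 * pi"
        using k[of 0] k[of N] d_pos[of "m 0"] d_pos[of "m N"] d_less[of "m 0"] d_less[of "m N"] by linarith
      then have "\<bar>((\<theta> N - \<theta> 0) - ((m N + d (m N)) - (m 0 + d (m 0)))) / (2 * pi)\<bar> \<le> 1"
        by (simp add: abs_divide)
      then show ?thesis
        using K[of N] unfolding diff_divide_distrib by linarith
    qed
    then have "(\<lambda>N. (\<theta> N - \<theta> 0) / (2 * pi) / real N) \<longlonglongrightarrow> ?R"
      by (rule tendsto_average_of_bounded_deviation)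
    then show "(\<lambda>N. (\<theta> N - \<theta> 0) / (2 * pi * real N)) \<longlonglongrightarrow> ?R"
      by simp
  qed
  show "r = ?R" if r: "\<forall>P \<theta>. circumscribing_trajectory a b l P \<and> lifted_polar_angle P \<theta> \<longrightarrow>
    (\<lambda>N. (\<theta> N - \<theta> 0) / (2 * pi * real N)) \<longlonglongrightarrow> r" for r
  proof -
    obtain m where m: "vertex_chain m"
      using vertex_chain_exists by blast
    moreover obtain \<theta> where "lifted_polar_angle (\<lambda>i. vertex (m i)) \<theta>"
      using lifted_polar_angle_exists[OF m] by blast
    ultimately show ?thesis
      using r lim LIMSEQ_unique circumscribing_trajectory_iff by blast
  qed
qed

section \<open>Perimeter, elliptic integral and mean edge length\<close>

lemma confocal_perimeter_eq:
  assumes S: "\<And>t. (S has_real_derivative speed t) (at t)"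
  shows "confocal_perimeter a b l = 4 * (S pi - S (pi / 2))"
proof -
  interpret sin_sq_antiderivative S "\<lambda>x. sqrt (b\<^sup>2 - l + (a\<^sup>2 - b\<^sup>2) * x)"
    by (rule sin_sq_antiderivative_speed[OF S])
  have deriv: "((\<lambda>s. Complex (A * cos s) (B * sin s)) has_vector_derivative caustic_tangent t) (at t)" for t
    unfolding caustic_tangent_def has_vector_derivative_complex_iff
    by (auto intro!: derivative_eq_intros)
  have "confocal_perimeter a b l = integral {0..2 * pi} speed"
    unfolding confocal_perimeter_def A_def[symmetric] B_def[symmetric]
    by (simp add: vector_derivative_at[OF deriv] norm_caustic_tangent)
  also have "\<dots> = S (2 * pi) - S 0"
    by (intro integral_eq_antiderivative_diff S) simp
  finally show ?thesis
    using shift_two_pi[of 0] by simp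
qed

text \<open>Counting the eccentric angle from the minor axis turns the speed into
  \<open>A * sqrt (1 - k^2 * (sin t)^2)\<close>, the Legendre form with
  \<open>k = c / A\<close>.\<close>

lemma elliptic_E_touch_angle:
  assumes S: "\<And>t. (S has_real_derivative speed t) (at t)"
  shows "sqrt (a\<^sup>2 - l) * elliptic_E touch_angle (sqrt (a\<^sup>2 - b\<^sup>2) / sqrt (a\<^sup>2 - l)) = S (pi / 2 + touch_angle) - S (pi / 2)"
proof -
  have speed_shift: "speed (pi / 2 + t) = A * sqrt (1 - (sqrt (a\<^sup>2 - b\<^sup>2) / A)\<^sup>2 * (sin t)\<^sup>2)" for t
  proof -
    have "A\<^sup>2 * (1 - (sqrt (a\<^sup>2 - b\<^sup>2) / A)\<^sup>2 * (sin t)\<^sup>2) = A\<^sup>2 - (a\<^sup>2 - b\<^sup>2) * (sin t)\<^sup>2"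
      using sq_ab A_pos by (simp add: power_divide right_diff_distrib)
    also have "\<dots> = b\<^sup>2 - l + (a\<^sup>2 - b\<^sup>2) * (sin (pi / 2 + t))\<^sup>2"
      by (simp add: A_sq sin_add cos_squared_eq algebra_simps)
    finally have "A\<^sup>2 * (1 - (sqrt (a\<^sup>2 - b\<^sup>2) / A)\<^sup>2 * (sin t)\<^sup>2) = b\<^sup>2 - l + (a\<^sup>2 - b\<^sup>2) * (sin (pi / 2 + t))\<^sup>2" .
    then have "speed (pi / 2 + t) = sqrt (A\<^sup>2 * (1 - (sqrt (a\<^sup>2 - b\<^sup>2) / A)\<^sup>2 * (sin t)\<^sup>2))"
      by (simp add: speed_def)
    then show ?thesis
      using A_pos by (simp add: real_sqrt_mult)
  qed
  have "((\<lambda>t. S (pi / 2 + t)) has_real_derivative speed (pi / 2 + t)) (at t)" for t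
    by (rule DERIV_cong[OF DERIV_chain2[OF S]]) (auto intro!: derivative_eq_intros)
  then have "S (pi / 2 + touch_angle) - S (pi / 2) = integral {0..touch_angle} (\<lambda>t. speed (pi / 2 + t))"
    using touch_angle_pos by (subst integral_eq_antiderivative_diff[where F = "\<lambda>t. S (pi / 2 + t)"]) auto
  then show ?thesis
    by (simp add: elliptic_E_def speed_shift A_def)
qed

lemma average_edge_length:
  assumes P: "circumscribing_trajectory a b l P"
  shows "(\<lambda>N. (\<Sum>i=1..N. dist (P (i - 1)) (P i)) / real N) \<longlonglongrightarrow>
    2 * a * sqrt l / b - 2 * sqrt (a\<^sup>2 - l) * elliptic_E touch_angle (sqrt (a\<^sup>2 - b\<^sup>2) / sqrt (a\<^sup>2 - l))
      + rotation_number a b l * confocal_perimeter a b l"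
proof -
  obtain m where m: "vertex_chain m" and P: "P = (\<lambda>i. vertex (m i))"
    using P unfolding circumscribing_trajectory_iff by blast
  obtain S where S: "\<And>t. (S has_real_derivative speed t) (at t)"
    using speed_antiderivative_exists by blast
  obtain H where H: "\<And>t. (H has_real_derivative 1 / speed t) (at t)"
    using inverse_speed_antiderivative_exists by blast
  interpret sin_sq_antiderivative S "\<lambda>x. sqrt (b\<^sup>2 - l + (a\<^sup>2 - b\<^sup>2) * x)"
    by (rule sin_sq_antiderivative_speed[OF S])
  define R where "R = rotation_number a b l"
  define V where "V = confocal_perimeter a b l"
  define Q where "Q = 2 * a * sqrt l / b - 2 * (S (pi / 2 + touch_angle) - S (pi / 2))"
  define \<tau> where "\<tau> i = m i + d (m i)" for i
  define r where "r i = tan (d (m i)) * speed (\<tau> i)" for i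
  have string: "tan (d n) * speed (n + d n) + tan (d n) * speed (n - d n) - (S (n + d n) - S (n - d n)) = Q" for n
  proof -
    have "tan touch_angle * speed (pi / 2 + touch_angle) + tan touch_angle * speed (pi / 2 - touch_angle) = 2 * \<kappa> * (sin touch_angle)\<^sup>2"
      using tangent_segments_sum[of "pi / 2"] by (simp only: d_pi_half)
    also have "\<dots> = 2 * a * sqrt l / b"
      using l0 b0 by (simp add: sin_touch_angle \<kappa>_def power_divide field_simps power2_eq_square)
    finally show ?thesis
      using string_length_const[OF S, of n "pi / 2"] reflect_pi_half[of touch_angle]
      by (simp add: Q_def d_pi_half)
  qed
  \<comment> \<open>An edge is the forward segment of one vertex plus the backward segment of the
    next. Replacing the latter by means of the string constant \<open>Q\<close> makes the sum
    telescope.\<close>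
  have edge: "dist (P i) (P (Suc i)) = r i + (Q + S (\<tau> (Suc i)) - S (\<tau> i) - r (Suc i))" for i
    using string[of "m (Suc i)"] vertex_chainD[OF m, of i]
    unfolding P edge_length[OF vertex_chainD[OF m]] r_def \<tau>_def by simp
  have sum: "(\<Sum>i=1..N. dist (P (i - 1)) (P i)) = real N * Q + (S (\<tau> N) - S (\<tau> 0)) + r 0 - r N" for N
    by (induction N) (simp_all add: edge algebra_simps)
  have perimeter: "2 * (S pi - S (pi / 2)) = V / 2"
    by (simp add: V_def confocal_perimeter_eq[OF S])
  obtain K\<^sub>S where K\<^sub>S: "\<And>t. \<bar>S t - t / pi * (V / 2)\<bar> \<le> K\<^sub>S"
    using linear_growth unfolding perimeter by blast
  obtain K where K: "\<And>N. \<bar>(\<tau> N - \<tau> 0) / (2 * pi) - real N * R\<bar> \<le> K"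
    using tangency_growth[OF m H] unfolding \<tau>_def R_def rotation_number_eq[OF H] by blast
  have "\<bar>(\<Sum>i=1..N. dist (P (i - 1)) (P i)) - real N * (Q + R * V)\<bar> \<le> 2 * K\<^sub>S + K * \<bar>V\<bar> + 2 * \<kappa>" for N
  proof -
    \<comment> \<open>Three bounded errors: arc length against linear growth, turns against
      \<open>N * R\<close> weighted by the perimeter, and the segments at the two ends.\<close>
    have split: "(\<Sum>i=1..N. dist (P (i - 1)) (P i)) - real N * (Q + R * V)
      = (S (\<tau> N) - \<tau> N / pi * (V / 2)) - (S (\<tau> 0) - \<tau> 0 / pi * (V / 2))
        + ((\<tau> N - \<tau> 0) / (2 * pi) - real N * R) * V + (r 0 - r N)"
      unfolding sum by (simp add: diff_divide_distrib algebra_simps)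
    have linear: "\<bar>((\<tau> N - \<tau> 0) / (2 * pi) - real N * R) * V\<bar> \<le> K * \<bar>V\<bar>"
      unfolding abs_mult by (intro mult_right_mono K) simp
    have ends: "\<bar>r 0 - r N\<bar> \<le> 2 * \<kappa>"
      using tangent_segment_bounds[of "m 0"] tangent_segment_bounds[of "m N"] unfolding r_def \<tau>_def by linarith
    have "\<bar>x - y + z + u\<bar> \<le> 2 * k + c + e"
      if "\<bar>x\<bar> \<le> k" "\<bar>y\<bar> \<le> k" "\<bar>z\<bar> \<le> c" "\<bar>u\<bar> \<le> e" for x y z u k c e :: real
      using that by linarith
    from this[OF K\<^sub>S K\<^sub>S linear ends] show ?thesis
      unfolding split .
  qed
  from tendsto_average_of_bounded_deviation[OF this]
  show ?thesis
    by (simp only: Q_def R_def V_def elliptic_E_touch_angle[OF S, symmetric] mult.assoc)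
qed

end

section \<open>Injectivity of the rotation number\<close>

text \<open>A table vertex on the minor axis sees the caustic under the parameter interval
  \<open>[pi / 2 - touch_angle, pi / 2 + touch_angle]\<close>. The two functions below are the values of the invariant
  measure \<open>dt / speed t\<close> on the half of this interval and on its complement in \<open>[pi / 2, pi]\<close>, in coordinates
  in which the integrands are visibly increasing and decreasing in \<open>l\<close>.\<close>

definition inner_time :: "real \<Rightarrow> real \<Rightarrow> real \<Rightarrow> real" where
  "inner_time a b l = integral {0..pi / 2}
     (\<lambda>x. sqrt l * cos x / (sqrt (b\<^sup>2 - l * (cos x)\<^sup>2) * sqrt (a\<^sup>2 - l * (cos x)\<^sup>2)))"

definition outer_time :: "real \<Rightarrow> real \<Rightarrow> real \<Rightarrow> real" where
  "outer_time a b l = integral {0..pi / 2}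
     (\<lambda>x. b * sin x / (sqrt (l * (cos x)\<^sup>2 + b\<^sup>2 * (sin x)\<^sup>2) * sqrt (a\<^sup>2 * (cos x)\<^sup>2 + b\<^sup>2 * (sin x)\<^sup>2)))"

context confocal_caustic
begin

lemma radicands_pos:
  "0 < b\<^sup>2 - l * (cos x)\<^sup>2" "0 < a\<^sup>2 - l * (cos x)\<^sup>2"
  "0 < l * (cos x)\<^sup>2 + b\<^sup>2 * (sin x)\<^sup>2" "0 < a\<^sup>2 * (cos x)\<^sup>2 + b\<^sup>2 * (sin x)\<^sup>2"
proof -
  have "l * (cos x)\<^sup>2 \<le> l * 1"
    using l0 by (intro mult_left_mono) (auto simp: abs_square_le_1)
  then show "0 < b\<^sup>2 - l * (cos x)\<^sup>2" "0 < a\<^sup>2 - l * (cos x)\<^sup>2"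
    using lb la by linarith+
  have mono: "0 < min p q * ((cos x)\<^sup>2 + (sin x)\<^sup>2) \<Longrightarrow> 0 < p * (cos x)\<^sup>2 + q * (sin x)\<^sup>2" for p q :: real
    unfolding distrib_left
    by (erule less_le_trans) (intro add_mono mult_right_mono, auto)
  show "0 < l * (cos x)\<^sup>2 + b\<^sup>2 * (sin x)\<^sup>2" "0 < a\<^sup>2 * (cos x)\<^sup>2 + b\<^sup>2 * (sin x)\<^sup>2"
    using l0 a0 b0 by (auto intro!: mono)
qed

text \<open>The substitution \<open>tan \<psi> = sqrt l * sin x / B\<close> maps the fixed interval
  \<open>[0, pi / 2]\<close> onto \<open>[0, touch_angle]\<close>, moving the dependence on
  \<open>l\<close> from the endpoint into the integrand.\<close>

lemma inner_time_eq:
  assumes H: "\<And>t. (H has_real_derivative 1 / speed t) (at t)"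
  shows "inner_time a b l = H (pi / 2 + touch_angle) - H (pi / 2)"
proof -
  let ?\<psi> = "\<lambda>x. arctan (sqrt l * sin x / B)"
  have "((\<lambda>x. H (pi / 2 + ?\<psi> x)) has_real_derivative
    sqrt l * cos x / (sqrt (b\<^sup>2 - l * (cos x)\<^sup>2) * sqrt (a\<^sup>2 - l * (cos x)\<^sup>2))) (at x)" for x
  proof -
    define p q where "p = sqrt (b\<^sup>2 - l * (cos x)\<^sup>2)" and "q = sqrt (a\<^sup>2 - l * (cos x)\<^sup>2)"
    have p: "p > 0" "p\<^sup>2 = b\<^sup>2 - l * (cos x)\<^sup>2" and q: "q > 0" "q\<^sup>2 = a\<^sup>2 - l * (cos x)\<^sup>2"
      using radicands_pos(1,2)[of x] by (auto simp: p_def q_def)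
    have "p\<^sup>2 = B\<^sup>2 + l * (sin x)\<^sup>2"
      by (simp add: p B_sq sin_squared_eq algebra_simps)
    then have tan_sq: "1 + (sqrt l * sin x / B)\<^sup>2 = p\<^sup>2 / B\<^sup>2"
      using B_pos l0 by (simp add: power_divide power_mult_distrib add_divide_distrib)
    have pq: "q\<^sup>2 = p\<^sup>2 + (a\<^sup>2 - b\<^sup>2)"
      by (simp add: p q)
    have "sin (pi / 2 + ?\<psi> x) = cos (?\<psi> x)"
      by (simp add: sin_add)
    then have "(speed (pi / 2 + ?\<psi> x))\<^sup>2 = B\<^sup>2 + (a\<^sup>2 - b\<^sup>2) * (1 / (p\<^sup>2 / B\<^sup>2))"
      by (simp only: speed_sq B_sq[symmetric] cos_arctan_squared tan_sq)
    also have "\<dots> = (B * q / p)\<^sup>2"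
      unfolding power_divide power_mult_distrib pq using p(1) B_pos
      by (simp add: add_divide_distrib distrib_left)
    finally have sp: "speed (pi / 2 + ?\<psi> x) = B * q / p"
      using speed_pos[of "pi / 2 + ?\<psi> x"] p q B_pos by (simp add: power2_eq_iff_nonneg)
    have "(?\<psi> has_real_derivative inverse (p\<^sup>2 / B\<^sup>2) * (sqrt l * cos x / B)) (at x)"
      unfolding tan_sq[symmetric] using B_pos
      by (auto intro!: derivative_eq_intros)
    then have "((\<lambda>x. pi / 2 + ?\<psi> x) has_real_derivative 0 + inverse (p\<^sup>2 / B\<^sup>2) * (sqrt l * cos x / B)) (at x)"
      by (intro DERIV_add DERIV_const)
    from DERIV_chain2[OF H this]
    show ?thesis
      unfolding sp p_def[symmetric] q_def[symmetric]
      by (rule DERIV_cong) (use p(1) q(1) B_pos in \<open>simp add: field_simps power2_eq_square\<close>)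
  qed
  then show ?thesis
    unfolding inner_time_def
    by (subst integral_eq_antiderivative_diff[where F = "\<lambda>x. H (pi / 2 + ?\<psi> x)"]) (auto simp: touch_angle_def)
qed

text \<open>On \<open>[0, pi / 2]\<close> the substitution amounts to
  \<open>sin t = (B / b) * cos x\<close>, with \<open>t\<close> running from
  \<open>pi / 2 + touch_angle\<close> to \<open>pi\<close>.\<close>

lemma outer_time_eq:
  assumes H: "\<And>t. (H has_real_derivative 1 / speed t) (at t)"
  shows "outer_time a b l = H pi - H (pi / 2 + touch_angle)"
proof -
  let ?y = "\<lambda>x. B * cos x / sqrt (l * (cos x)\<^sup>2 + b\<^sup>2 * (sin x)\<^sup>2)"
  have "((\<lambda>x. H (pi - arctan (?y x))) has_real_derivative
    b * sin x / (sqrt (l * (cos x)\<^sup>2 + b\<^sup>2 * (sin x)\<^sup>2) * sqrt (a\<^sup>2 * (cos x)\<^sup>2 + b\<^sup>2 * (sin x)\<^sup>2))) (at x)" for x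
  proof -
    define e q where "e = sqrt (l * (cos x)\<^sup>2 + b\<^sup>2 * (sin x)\<^sup>2)" and "q = sqrt (a\<^sup>2 * (cos x)\<^sup>2 + b\<^sup>2 * (sin x)\<^sup>2)"
    have e: "e > 0" "e\<^sup>2 = l * (cos x)\<^sup>2 + b\<^sup>2 * (sin x)\<^sup>2" and q: "q > 0" "q\<^sup>2 = a\<^sup>2 * (cos x)\<^sup>2 + b\<^sup>2 * (sin x)\<^sup>2"
      using radicands_pos(3,4)[of x] by (auto simp: e_def q_def)
    have eB: "e\<^sup>2 + B\<^sup>2 * (cos x)\<^sup>2 = b\<^sup>2"
      by (simp add: e B_sq sin_squared_eq algebra_simps)
    have y_sq: "1 + (?y x)\<^sup>2 = b\<^sup>2 / e\<^sup>2"
      using e(1) eB unfolding e_def[symmetric] by (simp add: power_divide power_mult_distrib field_simps)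
    have "(sin (arctan (?y x)))\<^sup>2 = 1 - e\<^sup>2 / b\<^sup>2"
      unfolding sin_squared_eq[of "arctan _"] cos_arctan_squared y_sq by simp
    also have "\<dots> = B\<^sup>2 * (cos x)\<^sup>2 / b\<^sup>2"
      using eB b0 by (simp add: field_simps)
    finally have "(speed (pi - arctan (?y x)))\<^sup>2 = B\<^sup>2 + (a\<^sup>2 - b\<^sup>2) * (B\<^sup>2 * (cos x)\<^sup>2 / b\<^sup>2)"
      by (simp add: speed_sq B_sq)
    also have "\<dots> = (B * q / b)\<^sup>2"
      using b0 by (simp add: q power_divide power_mult_distrib sin_squared_eq field_simps)
    finally have sp: "speed (pi - arctan (?y x)) = B * q / b"
      using speed_pos[of "pi - arctan (?y x)"] q b0 B_pos by (simp add: power2_eq_iff_nonneg)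
    have "((\<lambda>x. l * (cos x)\<^sup>2 + b\<^sup>2 * (sin x)\<^sup>2) has_real_derivative 2 * B\<^sup>2 * sin x * cos x) (at x)"
      by (auto intro!: derivative_eq_intros simp: B_sq algebra_simps)
    moreover have "((\<lambda>x. sqrt (u x)) has_real_derivative u' / (2 * sqrt (u x))) (at x)"
      if "(u has_real_derivative u') (at x)" "u x > 0" for u :: "real \<Rightarrow> real" and u'
      using that by (auto intro!: derivative_eq_intros simp: field_simps)
    ultimately have "((\<lambda>x. sqrt (l * (cos x)\<^sup>2 + b\<^sup>2 * (sin x)\<^sup>2)) has_real_derivative
        2 * B\<^sup>2 * sin x * cos x / (2 * e)) (at x)"
      unfolding e_def using radicands_pos(3)[of x] by blast
    moreover have "2 * B\<^sup>2 * sin x * cos x / (2 * e) = B\<^sup>2 * sin x * cos x / e"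
      by simp
    ultimately have de: "((\<lambda>x. sqrt (l * (cos x)\<^sup>2 + b\<^sup>2 * (sin x)\<^sup>2)) has_real_derivative B\<^sup>2 * sin x * cos x / e) (at x)"
      by metis
    have "(?y has_real_derivative ((- B * sin x) * e - B * cos x * (B\<^sup>2 * sin x * cos x / e)) / (e * e)) (at x)"
      unfolding e_def[symmetric]
    proof (rule DERIV_divide[OF _ de, folded e_def])
      show "((\<lambda>x. B * cos x) has_real_derivative - B * sin x) (at x)"
        by (auto intro!: derivative_eq_intros)
      show "e \<noteq> 0"
        using e(1) by simp
    qed
    moreover have "((- B * sin x) * e - B * cos x * (B\<^sup>2 * sin x * cos x / e)) / (e * e) = - (B * b\<^sup>2 * sin x / e ^ 3)"
      unfolding eB[symmetric] using e(1) by (simp add: field_simps power2_eq_square power3_eq_cube)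
    ultimately have dy: "(?y has_real_derivative - (B * b\<^sup>2 * sin x / e ^ 3)) (at x)"
      by simp
    have "((\<lambda>x. pi - arctan (?y x)) has_real_derivative 0 - inverse (1 + (?y x)\<^sup>2) * - (B * b\<^sup>2 * sin x / e ^ 3)) (at x)"
      by (intro DERIV_diff DERIV_const DERIV_chain2[OF DERIV_arctan dy])
    from DERIV_chain2[OF H this]
    show ?thesis
      unfolding sp y_sq unfolding e_def[symmetric] q_def[symmetric]
      by (rule DERIV_cong) (use e(1) q(1) b0 B_pos in \<open>simp add: field_simps power2_eq_square power3_eq_cube\<close>)
  qed
  note deriv = this
  have "B / sqrt l = 1 / (sqrt l / B)"
    by simp
  then have "pi - arctan (B / sqrt l) = pi / 2 + touch_angle"
    using arctan_inverse[of "sqrt l / B"] l0 B_pos by (simp add: touch_angle_def)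
  then show ?thesis
    unfolding outer_time_def
    by (subst integral_eq_antiderivative_diff[OF deriv]) auto
qed

lemma inner_time_pos: "inner_time a b l > 0" and outer_time_pos: "outer_time a b l > 0"
  and rotation_number_inner_outer: "rotation_number a b l = inner_time a b l / (2 * (inner_time a b l + outer_time a b l))"
proof -
  obtain H where H: "\<And>t. (H has_real_derivative 1 / speed t) (at t)"
    using inverse_speed_antiderivative_exists by blast
  have "H x < H y" if "x < y" for x y
    using that by (intro DERIV_pos_imp_increasing[where f = H]) (auto intro!: H exI speed_pos divide_pos_pos)
  then show "inner_time a b l > 0" "outer_time a b l > 0"
    using touch_angle_pos touch_angle_less by (simp_all add: inner_time_eq[OF H] outer_time_eq[OF H])
  show "rotation_number a b l = inner_time a b l / (2 * (inner_time a b l + outer_time a b l))"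
    unfolding rotation_number_eq[OF H] inner_time_eq[OF H] outer_time_eq[OF H] by simp
qed

lemma continuous_time_integrands:
  "continuous_on X (\<lambda>x. sqrt l * cos x / (sqrt (b\<^sup>2 - l * (cos x)\<^sup>2) * sqrt (a\<^sup>2 - l * (cos x)\<^sup>2)))"
  "continuous_on X (\<lambda>x. b * sin x / (sqrt (l * (cos x)\<^sup>2 + b\<^sup>2 * (sin x)\<^sup>2) * sqrt (a\<^sup>2 * (cos x)\<^sup>2 + b\<^sup>2 * (sin x)\<^sup>2)))"
  using radicands_pos[THEN less_imp_neq] by (auto intro!: continuous_intros)

end

text \<open>Inside the interval, increasing \<open>l\<close> increases the first integrand through
  its numerator and both radicands, and decreases the second, where \<open>l\<close> occurs only in
  the denominator. Both integrands vanish at one end, so strictness is used on the open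
  interval.\<close>

lemma rotation_number_strict_mono:
  assumes "confocal_caustic a b l" "confocal_caustic a b l'" "l < l'"
  shows "rotation_number a b l < rotation_number a b l'"
proof -
  interpret L: confocal_caustic a b l by fact
  interpret L': confocal_caustic a b l' by fact
  have "inner_time a b l < inner_time a b l'"
    unfolding inner_time_def
  proof (rule integral_less_real[OF L.continuous_time_integrands(1) L'.continuous_time_integrands(1)])
    fix x :: real
    assume "x \<in> {0<..<pi / 2}"
    then have "cos x > 0"
      by (simp add: cos_gt_zero)
    then show "sqrt l * cos x / (sqrt (b\<^sup>2 - l * (cos x)\<^sup>2) * sqrt (a\<^sup>2 - l * (cos x)\<^sup>2))
      < sqrt l' * cos x / (sqrt (b\<^sup>2 - l' * (cos x)\<^sup>2) * sqrt (a\<^sup>2 - l' * (cos x)\<^sup>2))"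
      using assms(3) L.l0 L'.radicands_pos[of x] L.radicands_pos[of x]
      by (intro frac_less mult_strict_right_mono mult_mono) auto
  qed (simp add: not_le)
  moreover have "outer_time a b l' < outer_time a b l"
    unfolding outer_time_def
  proof (rule integral_less_real[OF L'.continuous_time_integrands(2) L.continuous_time_integrands(2)])
    fix x :: real
    assume "x \<in> {0<..<pi / 2}"
    then have "cos x > 0" "sin x > 0"
      by (auto simp: cos_gt_zero intro!: sin_gt_zero)
    then show "b * sin x / (sqrt (l' * (cos x)\<^sup>2 + b\<^sup>2 * (sin x)\<^sup>2) * sqrt (a\<^sup>2 * (cos x)\<^sup>2 + b\<^sup>2 * (sin x)\<^sup>2))
      < b * sin x / (sqrt (l * (cos x)\<^sup>2 + b\<^sup>2 * (sin x)\<^sup>2) * sqrt (a\<^sup>2 * (cos x)\<^sup>2 + b\<^sup>2 * (sin x)\<^sup>2))"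
      using assms(3) L.b0 L'.radicands_pos[of x] L.radicands_pos[of x]
      by (intro divide_strict_left_mono mult_strict_right_mono mult_pos_pos) auto
  qed (simp add: not_le)
  ultimately have "inner_time a b l * outer_time a b l' < inner_time a b l' * outer_time a b l"
    using L.inner_time_pos L'.outer_time_pos by (intro mult_strict_mono) auto
  \<comment> \<open>After cross-multiplication the products of the two inner times cancel.\<close>
  then have "inner_time a b l * (2 * (inner_time a b l' + outer_time a b l'))
      < inner_time a b l' * (2 * (inner_time a b l + outer_time a b l))"
    by (simp add: algebra_simps)
  moreover have "x / p < x' / p'" if "x * p' < x' * p" "p > 0" "p' > 0" for x p x' p' :: real
    using that by (simp add: field_simps)
  ultimately show ?thesis
    unfolding L.rotation_number_inner_outer L'.rotation_number_inner_outer
    using L.inner_time_pos L.outer_time_pos L'.inner_time_pos L'.outer_time_pos by simp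
qed

theorem corollary2p2:
  fixes a b l c f \<rho> \<phi> k :: real
  assumes "a > b" and "b > 0"
    and "0 < l" and "l < b\<^sup>2"
    and "c = sqrt (a\<^sup>2 - b\<^sup>2)"
    and "f = sqrt (a\<^sup>2 - l) / c"
    and "\<rho> = rotation_number a b l"
    and "\<phi> = arcsin (sqrt l / b)"
    and "k = 1 / f"
  shows "mather_beta a b \<rho> =
           2 * a * sqrt l / b - 2 * sqrt (a\<^sup>2 - l) * elliptic_E \<phi> k
             + \<rho> * confocal_perimeter a b l"
proof -
  have caustic: "confocal_caustic a b l'" if "0 < l'" "l' < b\<^sup>2" for l'
    using assms that by unfold_locales
  note caustic_l = caustic[OF assms(3,4)]
  \<comment> \<open>\<open>mather_beta\<close> ranges over all caustics with rotation number
    \<open>\<rho>\<close>; injectivity leaves only the given one.\<close>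
  have unique: "l' = l" if "0 < l'" "l' < b\<^sup>2" "rotation_number a b l' = \<rho>" for l'
    using rotation_number_strict_mono[OF caustic_l caustic[OF that(1,2)]]
      rotation_number_strict_mono[OF caustic[OF that(1,2)] caustic_l] that(3) assms(7)
    by linarith
  have k: "k = sqrt (a\<^sup>2 - b\<^sup>2) / sqrt (a\<^sup>2 - l)"
    unfolding assms(5,6,9) by simp
  let ?L = "2 * a * sqrt l / b - 2 * sqrt (a\<^sup>2 - l) * elliptic_E \<phi> k + \<rho> * confocal_perimeter a b l"
  have lim: "(\<lambda>N. (\<Sum>i=1..N. dist (P (i - 1)) (P i)) / real N) \<longlonglongrightarrow> ?L"
    if "circumscribing_trajectory a b l P" for P
    using confocal_caustic.average_edge_length[OF caustic_l that]
    unfolding k assms(7,8) confocal_caustic.touch_angle_eq_arcsin[OF caustic_l] .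
  obtain P where P: "circumscribing_trajectory a b l P"
    using confocal_caustic.vertex_chain_exists[OF caustic_l]
      confocal_caustic.circumscribing_trajectory_iff[OF caustic_l] by blast
  show ?thesis
    unfolding mather_beta_def
  proof (rule the_equality)
    show "\<forall>l' P. 0 < l' \<and> l' < b\<^sup>2 \<and> rotation_number a b l' = \<rho> \<and> circumscribing_trajectory a b l' P \<longrightarrow>
        (\<lambda>N. (\<Sum>i=1..N. dist (P (i - 1)) (P i)) / real N) \<longlonglongrightarrow> ?L"
      using unique lim by blast
    show "L = ?L" if "\<forall>l' P. 0 < l' \<and> l' < b\<^sup>2 \<and> rotation_number a b l' = \<rho> \<and> circumscribing_trajectory a b l' P \<longrightarrow>
        (\<lambda>N. (\<Sum>i=1..N. dist (P (i - 1)) (P i)) / real N) \<longlonglongrightarrow> L" for L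
      using that assms(3,4,7) P lim[OF P] LIMSEQ_unique by blast
  qed
qed

end
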